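(* Let $M$ be a smooth manifold of dimension $m$, $TM$ its tangent bundle manifold and $\xi$ the tautological vector field on $TM$. For any $p\ge 0$ and any $p$-form $\alpha\in\Omega^p(M)$, the complete lift $\widetilde{\alpha}\in\Omega^p(TM)$ satisfies $$\mathcal{L}_\xi\widetilde{\alpha}=\widetilde{\alpha}.$$ In particular, every closed form $\alpha$ on $M$ yields an exact form $\widetilde{\alpha}=d(\xi\lrcorner\widetilde{\alpha})$ on $TM$. And thus, for all $0\le p\le m$, $H^p(TM)^{\sim}=0$.
   Context: $M$ is a smooth (Hausdorff, second countable) manifold of dimension $m$, with tangent bundle projection $\pi:TM\to M$. A chart $(x^i)$ on an open set $U\subset M$ induces the chart $(x^i,v^j)_{i,j=1,\dots,m}$ on $\pi^{-1}(U)$, where $v^j$ are the components of a tangent vector in the basis $\partial/\partial x^j$; $x^i$ and $dx^i$ also denote $\pi^*x^i$ and $\pi^*dx^i$. Summation over repeated indices. Tautological (Liouville) vector field: $\xi=v^i\frac{\partial}{\partial v^i}$, a globally defined vertical vector field on $TM$. $\mathcal{L}_\xi$ is the Lie derivative and $\xi\lrcorner$ the interior product (zero on functions). Complete lift of forms: $\alpha\mapsto\widetilde\alpha$, $\Omega^p(M)\to\Omega^p(TM)$, is the $\mathbb{R}$-linear, globally well-defined map given for a function $f$ by $\widetilde f(x,v)=v^j\frac{\partial f}{\partial x^j}$ (that is, $\widetilde f(u)=df(u)$), for a $1$-form $\alpha=a_i\,dx^i$ by $\widetilde\alpha=v^j\frac{\partial a_i}{\partial x^j}dx^i+a_i\,dv^i$,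 and in general determined by $\widetilde{\alpha\wedge\beta}=\widetilde\alpha\wedge\pi^*\beta+\pi^*\alpha\wedge\widetilde\beta$. Explicitly, for $\omega=\sum_{i_1<\dots<i_p}o_{i_1\cdots i_p}dx^{i_1}\wedge\cdots\wedge dx^{i_p}$, $$\widetilde\omega=\sum_{i_1<\dots<i_p}\Big(v^j\tfrac{\partial o_{i_1\cdots i_p}}{\partial x^j}dx^{i_1}\wedge\cdots\wedge dx^{i_p}+o_{i_1\cdots i_p}\sum_{k=1}^p dx^{i_1}\wedge\cdots\wedge dv^{i_k}\wedge\cdots\wedge dx^{i_p}\Big).$$ It satisfies $d\widetilde\alpha=\widetilde{d\alpha}$. $H^p(TM)^{\sim}$ denotes the space $\{\widetilde\alpha:\alpha\in\Omega^p(M),\ d\alpha=0\}$ modulo exact forms $\{d\beta:\beta\in\Omega^{p-1}(TM)\}$, i.e. the quotient of the first space by its intersection with the second (equivalently, the subspace of the de Rham space $H^p(TM)$ formed by the classes $[\widetilde\alpha]$ with $\alpha$ closed); for $p=0$ the space of exact forms is $0$. *)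

theory Defs
  imports "HOL-Analysis.Analysis" "HOL-Combinatorics.Permutations"
begin

section \<open>Smooth manifolds\<close>

text \<open>
  The model space is a real inner product space with an orthonormal basis
  e 0, ..., e (m - 1), which identifies it with R^m; the i-th coordinate of y is the inner
  product of y with e i. The class euclidean_space is not used here because it
  excludes dimension m = 0.
\<close>

definition euclidean_frame :: "(nat \<Rightarrow> 'e::real_inner) \<Rightarrow> nat \<Rightarrow> bool" where
  "euclidean_frame e m \<longleftrightarrow>
     (\<forall>i<m. \<forall>j<m. e i \<bullet> e j = (if i = j then 1 else 0)) \<and> span (e ` {..<m}) = UNIV"

text \<open>On an open subset of a finite-dimensional space, C^(k+1) means: differentiable, and all
  directional derivatives in fixed directions are C^k.\<close>

primrec C_k_on :: "nat \<Rightarrow> ('b::real_normed_vector \<Rightarrow> 'c::real_normed_vector) \<Rightarrow> 'b set \<Rightarrow> bool" where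
  "C_k_on 0 f S \<longleftrightarrow> continuous_on S f"
| "C_k_on (Suc k) f S \<longleftrightarrow>
     (\<forall>x\<in>S. f differentiable (at x)) \<and> (\<forall>v. C_k_on k (\<lambda>x. frechet_derivative f (at x) v) S)"

definition smooth_on :: "('b::real_normed_vector \<Rightarrow> 'c::real_normed_vector) \<Rightarrow> 'b set \<Rightarrow> bool" where
  "smooth_on f S \<longleftrightarrow> (\<forall>k. C_k_on k f S)"

text \<open>A chart is a pair of its domain U and the coordinate map, which is only relevant on U.\<close>

type_synonym ('a, 'e) chart = "'a set \<times> ('a \<Rightarrow> 'e)"

definition chart_inv :: "('a, 'e) chart \<Rightarrow> 'e \<Rightarrow> 'a" where
  "chart_inv c = inv_into (fst c) (snd c)"

definition transition :: "('a, 'e) chart \<Rightarrow> ('a, 'e) chart \<Rightarrow> 'e \<Rightarrow> 'e" where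
  "transition c c' = snd c' \<circ> chart_inv c"

text \<open>The atlas need not be maximal.\<close>

definition smooth_manifold :: "'a topology \<Rightarrow> ('a, 'e::real_inner) chart set \<Rightarrow> bool" where
  "smooth_manifold X A \<longleftrightarrow>
     Hausdorff_space X \<and> second_countable X \<and>
     \<Union>(fst ` A) = topspace X \<and>
     (\<forall>(U, \<phi>)\<in>A. openin X U \<and> open (\<phi> ` U) \<and>
        homeomorphic_map (subtopology X U) (top_of_set (\<phi> ` U)) \<phi>) \<and>
     (\<forall>c\<in>A. \<forall>c'\<in>A. smooth_on (transition c c') (snd c ` (fst c \<inter> fst c')))"

text \<open>All notions below depend on the atlas only; the topology is determined by it.\<close>

definition carrier :: "('a, 'e) chart set \<Rightarrow> 'a set" where
  "carrier A = \<Union>(fst ` A)"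

definition chart_at :: "('a, 'e) chart set \<Rightarrow> 'a \<Rightarrow> ('a, 'e) chart" where
  "chart_at A x = (SOME c. c \<in> A \<and> x \<in> fst c)"

section \<open>Tangent vectors\<close>

text \<open>
  A tangent vector at x assigns to each chart around x its components in that chart, subject to
  the usual transformation rule. Linear combinations are formed chartwise.
  The value 0 off the charts around x only serves to make equality of tangent vectors equality
  of functions.
\<close>

type_synonym ('a, 'e) tvec = "('a, 'e) chart \<Rightarrow> 'e"

definition tangent_space :: "('a, 'e::real_inner) chart set \<Rightarrow> 'a \<Rightarrow> ('a, 'e) tvec set" where
  "tangent_space A x =
     {v. (\<forall>c\<in>A. \<forall>c'\<in>A. x \<in> fst c \<and> x \<in> fst c' \<longrightarrow>
            v c' = frechet_derivative (transition c c') (at (snd c x)) (v c)) \<and>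
         (\<forall>c. \<not> (c \<in> A \<and> x \<in> fst c) \<longrightarrow> v c = 0)}"

text \<open>The tangent vector at x whose components in the chart c are w. Taking w to be the i-th
  vector of the frame gives the coordinate vector d/dx^i.\<close>

definition tvec_of :: "('a, 'e::real_inner) chart set \<Rightarrow> ('a, 'e) chart \<Rightarrow> 'a \<Rightarrow> 'e \<Rightarrow> ('a, 'e) tvec" where
  "tvec_of A c x w =
     (\<lambda>c'. if c' \<in> A \<and> x \<in> fst c'
           then frechet_derivative (transition c c') (at (snd c x)) w else 0)"

section \<open>Differential forms\<close>

text \<open>A form evaluates a list of tangent vectors at a point. Forms of degree p vanish by
  convention on arguments other than p tangent vectors at a point of the manifold, so that
  equality of forms is equality of functions.\<close>

type_synonym ('a, 'e) form = "'a \<Rightarrow> ('a, 'e) tvec list \<Rightarrow> real"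

definition zero_form :: "('a, 'e) form" where
  "zero_form = (\<lambda>x vs. 0)"

text \<open>The form in the coordinates of the chart c, evaluated on constant coefficient vectors.\<close>

definition local_form ::
  "('a, 'e::real_inner) chart set \<Rightarrow> ('a, 'e) chart \<Rightarrow> ('a, 'e) form \<Rightarrow> 'e \<Rightarrow> 'e list \<Rightarrow> real" where
  "local_form A c \<omega> y ws = \<omega> (chart_inv c y) (map (tvec_of A c (chart_inv c y)) ws)"

definition forms :: "('a, 'e::real_inner) chart set \<Rightarrow> nat \<Rightarrow> ('a, 'e) form set" where
  "forms A p =
     {\<omega>. (\<forall>x vs. \<not> (x \<in> carrier A \<and> length vs = p \<and> set vs \<subseteq> tangent_space A x) \<longrightarrow> \<omega> x vs = 0) \<and>
         (\<forall>x\<in>carrier A. \<forall>vs. length vs = p \<and> set vs \<subseteq> tangent_space A x \<longrightarrow>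
            (\<forall>i<p. \<forall>u\<in>tangent_space A x. \<forall>w\<in>tangent_space A x. \<forall>a b.
               \<omega> x (vs[i := (\<lambda>c. a *\<^sub>R u c + b *\<^sub>R w c)]) = a * \<omega> x (vs[i := u]) + b * \<omega> x (vs[i := w])) \<and>
            (\<forall>i<p. \<forall>j<p. i \<noteq> j \<and> vs ! i = vs ! j \<longrightarrow> \<omega> x vs = 0)) \<and>
         (\<forall>c\<in>A. \<forall>ws. smooth_on (\<lambda>y. local_form A c \<omega> y ws) (snd c ` fst c))}"

text \<open>
  In coordinates, the exterior derivative of sum_I o_I dx^I is sum_I sum_j (d o_I / d x^j) dx^j dx^I,
  with wedge products normalised so that (dx^1 ... dx^p) (v_1, ..., v_p) is a determinant without
  factor 1/p!. Evaluated on vectors, this is the alternating sum below. It does not depend on the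
  chart.
\<close>

definition local_ext_deriv :: "('e::real_inner \<Rightarrow> 'e list \<Rightarrow> real) \<Rightarrow> 'e \<Rightarrow> 'e list \<Rightarrow> real" where
  "local_ext_deriv f y ws =
     (\<Sum>i<length ws. (- 1) ^ i *
        frechet_derivative (\<lambda>z. f z (take i ws @ drop (Suc i) ws)) (at y) (ws ! i))"

definition ext_deriv :: "('a, 'e::real_inner) chart set \<Rightarrow> ('a, 'e) form \<Rightarrow> ('a, 'e) form" where
  "ext_deriv A \<omega> x vs =
     (if x \<in> carrier A \<and> set vs \<subseteq> tangent_space A x then
        let c = chart_at A x
        in local_ext_deriv (local_form A c \<omega>) (snd c x) (map (\<lambda>v. v c) vs)
      else 0)"

definition closed_forms :: "('a, 'e::real_inner) chart set \<Rightarrow> nat \<Rightarrow> ('a, 'e) form set" where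
  "closed_forms A p = {\<omega> \<in> forms A p. ext_deriv A \<omega> = zero_form}"

definition exact_forms :: "('a, 'e::real_inner) chart set \<Rightarrow> nat \<Rightarrow> ('a, 'e) form set" where
  "exact_forms A p = (if p = 0 then {zero_form} else ext_deriv A ` forms A (p - 1))"

text \<open>On forms of degree 0 this is zero, as they vanish on nonempty lists.\<close>

definition interior_product :: "('a \<Rightarrow> ('a, 'e) tvec) \<Rightarrow> ('a, 'e) form \<Rightarrow> ('a, 'e) form" where
  "interior_product X \<omega> x vs = \<omega> x (X x # vs)"

text \<open>
  The Lie derivative of a form is the derivative at t = 0 of its pullback along the flow of the
  vector field. The flow is taken locally, in a chart whose image is S; F is the vector field in
  that chart.
\<close>

definition local_flow ::
  "('e::real_inner \<Rightarrow> 'e) \<Rightarrow> 'e set \<Rightarrow> real \<Rightarrow> 'e set \<Rightarrow> (real \<times> 'e \<Rightarrow> 'e) \<Rightarrow> bool" where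
  "local_flow F S \<epsilon> V \<Psi> \<longleftrightarrow>
     \<epsilon> > 0 \<and> open V \<and> V \<subseteq> S \<and> smooth_on \<Psi> ({- \<epsilon><..<\<epsilon>} \<times> V) \<and> \<Psi> ` ({- \<epsilon><..<\<epsilon>} \<times> V) \<subseteq> S \<and>
     (\<forall>y\<in>V. \<Psi> (0, y) = y \<and>
        (\<forall>t\<in>{- \<epsilon><..<\<epsilon>}. ((\<lambda>s. \<Psi> (s, y)) has_vector_derivative F (\<Psi> (t, y))) (at t)))"

definition local_lie_deriv ::
  "('e::real_inner \<Rightarrow> 'e) \<Rightarrow> 'e set \<Rightarrow> ('e \<Rightarrow> 'e list \<Rightarrow> real) \<Rightarrow> 'e \<Rightarrow> 'e list \<Rightarrow> real" where
  "local_lie_deriv F S f y ws =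
     (let \<Psi> = (SOME \<Psi>. \<exists>\<epsilon> V. y \<in> V \<and> local_flow F S \<epsilon> V \<Psi>)
      in deriv (\<lambda>t. f (\<Psi> (t, y)) (map (frechet_derivative (\<lambda>z. \<Psi> (t, z)) (at y)) ws)) 0)"

definition lie_deriv ::
  "('a, 'e::real_inner) chart set \<Rightarrow> ('a \<Rightarrow> ('a, 'e) tvec) \<Rightarrow> ('a, 'e) form \<Rightarrow> ('a, 'e) form" where
  "lie_deriv A X \<omega> x vs =
     (if x \<in> carrier A \<and> set vs \<subseteq> tangent_space A x then
        let c = chart_at A x
        in local_lie_deriv (\<lambda>y. X (chart_inv c y) c) (snd c ` fst c) (local_form A c \<omega>)
             (snd c x) (map (\<lambda>v. v c) vs)
      else 0)"

section \<open>The tangent bundle\<close>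

text \<open>Points of the tangent bundle are pairs (x, v) with v a tangent vector at x. A chart with
  coordinates x^i induces the chart (x^i, v^j), where v^j are the components of v.\<close>

type_synonym ('a, 'e) tpoint = "'a \<times> ('a, 'e) tvec"

definition tangent_chart ::
  "('a, 'e::real_inner) chart set \<Rightarrow> ('a, 'e) chart \<Rightarrow> (('a, 'e) tpoint, 'e \<times> 'e) chart" where
  "tangent_chart A c = (Sigma (fst c) (tangent_space A), \<lambda>(x, v). (snd c x, v c))"

definition tangent_atlas ::
  "('a, 'e::real_inner) chart set \<Rightarrow> (('a, 'e) tpoint, 'e \<times> 'e) chart set" where
  "tangent_atlas A = tangent_chart A ` A"

text \<open>The vector field v^i d/dv^i has, in an induced chart, x-components 0 and v-components v^i.\<close>

definition tautological_field ::
  "('a, 'e::real_inner) chart set \<Rightarrow> ('a, 'e) tpoint \<Rightarrow> (('a, 'e) tpoint, 'e \<times> 'e) tvec" where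
  "tautological_field A q =
     (let c = chart_at A (fst q)
      in tvec_of (tangent_atlas A) (tangent_chart A c) q (0, snd q c))"

section \<open>Complete lift\<close>

definition wedge :: "('b \<Rightarrow> real) list \<Rightarrow> 'b list \<Rightarrow> real" where
  "wedge \<theta>s vs =
     (\<Sum>\<sigma> | \<sigma> permutes {..<length \<theta>s}.
        of_int (sign \<sigma>) * (\<Prod>k<length \<theta>s. (\<theta>s ! k) (vs ! \<sigma> k)))"

definition dx :: "(nat \<Rightarrow> 'e::real_inner) \<Rightarrow> nat \<Rightarrow> 'e \<times> 'e \<Rightarrow> real" where
  "dx e i = (\<lambda>(a, b). a \<bullet> e i)"

definition dv :: "(nat \<Rightarrow> 'e::real_inner) \<Rightarrow> nat \<Rightarrow> 'e \<times> 'e \<Rightarrow> real" where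
  "dv e i = (\<lambda>(a, b). b \<bullet> e i)"

text \<open>Here f is a form in coordinates x^i, and the result is its lift at the point with
  coordinates (y, u). The index set I is listed as i_1 < ... < i_p.\<close>

definition local_complete_lift ::
  "(nat \<Rightarrow> 'e::real_inner) \<Rightarrow> nat \<Rightarrow> ('e \<Rightarrow> 'e list \<Rightarrow> real) \<Rightarrow> 'e \<times> 'e \<Rightarrow> ('e \<times> 'e) list \<Rightarrow> real" where
  "local_complete_lift e m f = (\<lambda>(y, u) ws.
     \<Sum>I | I \<subseteq> {..<m} \<and> card I = length ws.
       let is = sorted_list_of_set I; coef = (\<lambda>z. f z (map e is))
       in (\<Sum>j<m. (u \<bullet> e j) * frechet_derivative coef (at y) (e j)) * wedge (map (dx e) is) ws
          + coef y * (\<Sum>k<length is. wedge ((map (dx e) is)[k := dv e (is ! k)]) ws))"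

text \<open>The lift does not depend on the chart.\<close>

definition complete_lift ::
  "(nat \<Rightarrow> 'e::real_inner) \<Rightarrow> nat \<Rightarrow> ('a, 'e) chart set \<Rightarrow> ('a, 'e) form \<Rightarrow>
     (('a, 'e) tpoint, 'e \<times> 'e) form" where
  "complete_lift e m A \<alpha> q vs =
     (if q \<in> carrier (tangent_atlas A) \<and> set vs \<subseteq> tangent_space (tangent_atlas A) q then
        let c = chart_at A (fst q)
        in local_complete_lift e m (local_form A c \<alpha>) (snd (tangent_chart A c) q)
             (map (\<lambda>v. v (tangent_chart A c)) vs)
      else 0)"

text \<open>The quotient of the lifts of closed forms by those lifts that are exact, as a set of
  equivalence classes.\<close>

definition closed_lifts ::
  "(nat \<Rightarrow> 'e::real_inner) \<Rightarrow> nat \<Rightarrow> ('a, 'e) chart set \<Rightarrow> nat \<Rightarrow> (('a, 'e) tpoint, 'e \<times> 'e) form set" where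
  "closed_lifts e m A p = complete_lift e m A ` closed_forms A p"

definition cohomologous_lifts ::
  "(nat \<Rightarrow> 'e::real_inner) \<Rightarrow> nat \<Rightarrow> ('a, 'e) chart set \<Rightarrow> nat \<Rightarrow>
     ((('a, 'e) tpoint, 'e \<times> 'e) form \<times> (('a, 'e) tpoint, 'e \<times> 'e) form) set" where
  "cohomologous_lifts e m A p =
     {(\<eta>, \<theta>). \<eta> \<in> closed_lifts e m A p \<and> \<theta> \<in> closed_lifts e m A p \<and>
        (\<lambda>q vs. \<eta> q vs - \<theta> q vs) \<in> exact_forms (tangent_atlas A) p}"

definition lift_cohomology ::
  "(nat \<Rightarrow> 'e::real_inner) \<Rightarrow> nat \<Rightarrow> ('a, 'e) chart set \<Rightarrow> nat \<Rightarrow>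
     (('a, 'e) tpoint, 'e \<times> 'e) form set set" where
  "lift_cohomology e m A p = closed_lifts e m A p // cohomologous_lifts e m A p"

end

theory Submission
  imports Defs
begin

text \<open>The complete lift has an invariant description. In a chart with coordinates \<open>x\<close>, write a form as a
function \<open>f y ws\<close>, alternating and multilinear in the list \<open>ws\<close> of coefficient vectors. Then the
complete lift at \<open>(y, u)\<close>, evaluated on vectors \<open>(a\<^sub>k, b\<^sub>k)\<close>, is the derivative at \<open>t = 0\<close> of
\<open>f (y + t u; a\<^sub>1 + t b\<^sub>1, \<dots>, a\<^sub>p + t b\<^sub>p)\<close>, that is, the derivative of \<open>f\<close> in direction \<open>u\<close> on the
fixed vectors \<open>a\<^sub>k\<close> plus the sum over \<open>k\<close> of \<open>f y\<close> with \<open>a\<^sub>k\<close> replaced by \<open>b\<^sub>k\<close>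
(\<open>intrinsic_lift\<close>, \<open>local_complete_lift_eq_intrinsic_lift\<close>).

Everything is read off from this formula.

\<^item> It is compatible with coordinate changes: the second derivatives of a transition map appear both
  in the derivative of the pullback of \<open>f\<close> and in the transformation of the \<open>b\<^sub>k\<close>, and the two
  agree because second derivatives are symmetric (\<open>intrinsic_lift_natural\<close>). Hence the complete
  lift, which is defined
  with one arbitrarily chosen chart per point, is given by the same formula in every chart
  (\<open>complete_lift_in_chart\<close>), and in particular it is smooth.

\<^item> It is linear under scaling of the fibre variables: replacing \<open>u\<close> and all \<open>b\<^sub>k\<close> by \<open>c u\<close> and
  \<open>c b\<^sub>k\<close> multiplies it by \<open>c\<close> (\<open>intrinsic_lift_homogeneous\<close>). The flow of the tautological field is
  \<open>(y, u) \<mapsto> (y, e\<^sup>t u)\<close>, so pulling the lift back along the flow multiplies it by \<open>e\<^sup>t\<close>, whose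
  derivative at \<open>t = 0\<close> is \<open>1\<close> (\<open>lie_deriv_complete_lift\<close>).

\<^item> Contracting it with the tautological field \<open>(0, u)\<close> leaves \<open>f (y; u, a\<^sub>2, \<dots>, a\<^sub>p)\<close>
  (\<open>intrinsic_lift_contraction\<close>). Differentiating this with respect to \<open>(y, u)\<close> and alternating gives
  the terms with \<open>b\<^sub>k\<close> of the lift and, besides, terms which the equation \<open>d f = 0\<close> evaluated on
  \<open>u, a\<^sub>1, \<dots>, a\<^sub>p\<close> identifies with the derivative of \<open>f\<close> in direction \<open>u\<close>
  (\<open>lift_eq_ext_deriv_of_contraction\<close>). This is Cartan's formula
  \<open>L\<^sub>\<xi> = d i\<^sub>\<xi> + i\<^sub>\<xi> d\<close> for the closed form in question, verified
  directly.

Since lifts of closed forms are exact and exact forms are closed under differences, any two lifts of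
closed forms are cohomologous and the quotient is a single class.\<close>

section \<open>Alternating multilinear functions of lists of vectors\<close>

lemma frame_inner: "euclidean_frame e m \<Longrightarrow> i < m \<Longrightarrow> j < m \<Longrightarrow> e i \<bullet> e j = (if i = j then 1 else 0)"
  by (simp add: euclidean_frame_def)

lemma frame_expansion:
  assumes "euclidean_frame e m"
  shows "u = (\<Sum>j<m. (u \<bullet> e j) *\<^sub>R e j)"
proof -
  define d where "d = u - (\<Sum>j<m. (u \<bullet> e j) *\<^sub>R e j)"
  have orth: "d \<bullet> e i = 0" if "i < m" for i
  proof -
    have "(\<Sum>j<m. (u \<bullet> e j) *\<^sub>R e j) \<bullet> e i = (\<Sum>j<m. if j = i then u \<bullet> e i else 0)"
      unfolding inner_sum_left by (rule sum.cong) (auto simp: frame_inner[OF assms] that)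
    then show ?thesis using that by (simp add: d_def inner_diff_left)
  qed
  have "d \<in> span (e ` {..<m})" using assms by (simp add: euclidean_frame_def)
  then have "d \<bullet> d = 0"
    by (rule span_induct) (auto simp: subspace_def inner_right_distrib orth)
  then show ?thesis by (simp add: d_def)
qed

lemma linear_frame_expansion:
  fixes g :: "'e::real_inner \<Rightarrow> 'c::real_vector"
  assumes "euclidean_frame e m" "linear g"
  shows "g u = (\<Sum>j<m. (u \<bullet> e j) *\<^sub>R g (e j))"
  by (subst frame_expansion[OF assms(1), of u])
     (simp add: linear_sum[OF assms(2)] linear_cmul[OF assms(2)])

text \<open>Forms take a list of arguments, so multilinearity and alternation are properties of a function on lists
of a fixed length, in the same shape in which \<open>forms\<close> states them. Values on lists of other lengths
are unconstrained.\<close>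

definition multilinear :: "nat \<Rightarrow> ('b::real_vector list \<Rightarrow> real) \<Rightarrow> bool" where
  "multilinear n F \<longleftrightarrow> (\<forall>ws i u w a b. length ws = n \<longrightarrow> i < n \<longrightarrow>
     F (ws[i := a *\<^sub>R u + b *\<^sub>R w]) = a * F (ws[i := u]) + b * F (ws[i := w]))"

definition alternating :: "nat \<Rightarrow> ('b list \<Rightarrow> real) \<Rightarrow> bool" where
  "alternating n F \<longleftrightarrow> (\<forall>ws i j. length ws = n \<longrightarrow> i < n \<longrightarrow> j < n \<longrightarrow> i \<noteq> j \<longrightarrow>
     ws ! i = ws ! j \<longrightarrow> F ws = 0)"

lemma multilinearD:
  "multilinear n F \<Longrightarrow> length ws = n \<Longrightarrow> i < n \<Longrightarrow>
     F (ws[i := a *\<^sub>R u + b *\<^sub>R w]) = a * F (ws[i := u]) + b * F (ws[i := w])"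
  unfolding multilinear_def by blast

lemma alternatingD:
  "alternating n F \<Longrightarrow> length ws = n \<Longrightarrow> i < n \<Longrightarrow> j < n \<Longrightarrow> i \<noteq> j \<Longrightarrow> ws ! i = ws ! j \<Longrightarrow> F ws = 0"
  unfolding alternating_def by blast

lemma linear_slot:
  assumes "multilinear n F" "length ws = n" "i < n"
  shows "linear (\<lambda>u. F (ws[i := u]))"
proof (rule linearI)
  show "F (ws[i := u + w]) = F (ws[i := u]) + F (ws[i := w])" for u w
    using multilinearD[OF assms, of 1 u 1 w] by simp
  show "F (ws[i := a *\<^sub>R u]) = a *\<^sub>R F (ws[i := u])" for a u
    using multilinearD[OF assms, of a u 0 u] by simp
qed

lemma multilinear_Cons:
  assumes "multilinear (Suc n) F"
  shows "multilinear n (\<lambda>ws. F (u # ws))"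
  unfolding multilinear_def
proof (intro allI impI)
  fix ws :: "'a list" and i v w a b
  assume "length ws = n" "i < n"
  then show "F (u # ws[i := a *\<^sub>R v + b *\<^sub>R w]) = a * F (u # ws[i := v]) + b * F (u # ws[i := w])"
    using multilinearD[OF assms, of "u # ws" "Suc i" a v b w] by simp
qed

lemma linear_Cons:
  assumes "multilinear (Suc n) F" "length ws = n"
  shows "linear (\<lambda>u. F (u # ws))"
  using linear_slot[OF assms(1), of "0 # ws" 0] assms(2) by simp

lemma alternating_Cons:
  assumes "alternating (Suc n) F"
  shows "alternating n (\<lambda>ws. F (u # ws))"
  unfolding alternating_def
proof (intro allI impI)
  fix ws :: "'a list" and i j
  assume "length ws = n" "i < n" "j < n" "i \<noteq> j" "ws ! i = ws ! j"
  then show "F (u # ws) = 0"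
    using alternatingD[OF assms, of "u # ws" "Suc i" "Suc j"] by simp
qed

lemma multilinear_expand_first:
  assumes "euclidean_frame e m" "multilinear (Suc n) F" "length ws = n"
  shows "F (u # ws) = (\<Sum>j<m. (u \<bullet> e j) * F (e j # ws))"
  using linear_frame_expansion[OF assms(1) linear_Cons[OF assms(2,3)], of u] by simp

text \<open>Expand the value, which is \<open>0\<close>, on a list having \<open>x + y\<close> in two adjacent places.\<close>

lemma alternating_swap:
  assumes ml: "multilinear n F" and al: "alternating n F" and len: "length (xs @ x # y # ys) = n"
  shows "F (xs @ x # y # ys) = - F (xs @ y # x # ys)"
proof -
  let ?i = "length xs"
  have i: "?i < n" "Suc ?i < n" using len by auto
  have upd: "(xs @ a # b # ys)[?i := c] = xs @ c # b # ys"
       "(xs @ a # b # ys)[Suc ?i := c] = xs @ a # c # ys" for a b c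
    by (simp_all add: list_update_append)
  have add1: "F (xs @ (a + b) # c # ys) = F (xs @ a # c # ys) + F (xs @ b # c # ys)" for a b c
    using multilinearD[OF ml _ i(1), of "xs @ x # c # ys" 1 a 1 b] len by (simp add: upd)
  have add2: "F (xs @ c # (a + b) # ys) = F (xs @ c # a # ys) + F (xs @ c # b # ys)" for a b c
    using multilinearD[OF ml _ i(2), of "xs @ c # x # ys" 1 a 1 b] len by (simp add: upd)
  have zero: "F (xs @ a # a # ys) = 0" for a
    using len by (intro alternatingD[OF al, of _ ?i "Suc ?i"]) (auto simp: nth_append)
  have "0 = F (xs @ (x + y) # (x + y) # ys)" by (simp add: zero)
  also have "\<dots> = F (xs @ x # y # ys) + F (xs @ y # x # ys)"
    by (subst add1) (simp add: add2 zero)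
  finally show ?thesis by linarith
qed

lemma alternating_move_to_front:
  assumes ml: "multilinear n F" and al: "alternating n F" and len: "length (xs @ b # ys) = n"
  shows "F (xs @ b # ys) = (- 1) ^ length xs * F (b # xs @ ys)"
  using len
proof (induction xs arbitrary: ys rule: rev_induct)
  case (snoc x xs)
  have "F (xs @ x # b # ys) = - F (xs @ b # x # ys)"
    using snoc.prems by (intro alternating_swap[OF ml al]) simp
  then show ?case using snoc.IH[of "x # ys"] snoc.prems by simp
qed simp

text \<open>The argument list of the \<open>i\<close>-th term of \<open>local_ext_deriv\<close>.\<close>

definition omit :: "nat \<Rightarrow> 'b list \<Rightarrow> 'b list" where
  "omit i ws = take i ws @ drop (Suc i) ws"

lemma length_omit [simp]: "i < length ws \<Longrightarrow> length (omit i ws) = length ws - 1"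
  by (simp add: omit_def)

lemma map_omit: "map f (omit i ws) = omit i (map f ws)"
  by (simp add: omit_def take_map drop_map)

lemma omit_0_Cons [simp]: "omit 0 (w # ws) = ws"
  by (simp add: omit_def)

lemma omit_Suc_Cons [simp]: "omit (Suc i) (w # ws) = w # omit i ws"
  by (simp add: omit_def)

lemma alternating_update:
  assumes "multilinear n F" "alternating n F" "length ws = n" "k < n"
  shows "F (ws[k := b]) = (- 1) ^ k * F (b # omit k ws)"
  using alternating_move_to_front[OF assms(1,2), of "take k ws" b "drop (Suc k) ws"] assms(3,4)
  by (simp add: upd_conv_take_nth_drop omit_def)

text \<open>An increasing sequence of indices is reached from any other order by insertion sort, and
  each insertion only changes the sign.\<close>

lemma alternating_insort:
  fixes e :: "nat \<Rightarrow> 'e::real_inner"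
  assumes ml: "multilinear n F" and al: "alternating n F"
  shows "length (pre @ xs) = n \<Longrightarrow> F (map e (pre @ sort xs)) = 0 \<Longrightarrow> F (map e (pre @ xs)) = 0"
proof (induction xs arbitrary: pre)
  case (Cons x xs)
  obtain us vs where uv: "sort xs = us @ vs" "insort x (sort xs) = us @ x # vs"
  proof -
    have "\<exists>us vs. ys = us @ vs \<and> insort x ys = us @ x # vs" for ys
    proof (induction ys)
      case (Cons y ys)
      then obtain us vs where *: "ys = us @ vs" "insort x ys = us @ x # vs" by blast
      show ?case
      proof (cases "x \<le> y")
        case True
        then show ?thesis by (intro exI[of _ "[]"] exI[of _ "y # ys"]) simp
      next
        case False
        then show ?thesis using * by (intro exI[of _ "y # us"] exI[of _ vs]) simp
      qed
    qed simp
    then show ?thesis using that by blast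
  qed
  have len: "length us + length vs = length xs"
    using uv(1) by (metis length_append length_sort)
  have "F (map e ((pre @ us) @ x # vs)) = 0" using Cons.prems(2) uv by simp
  then have "F (map e x' @ e x # map e vs) = 0" if "x' = pre @ us" for x' using that by simp
  then have "F (e x # map e (pre @ us) @ map e vs) = 0"
    using alternating_move_to_front[OF ml al, of "map e (pre @ us)" "e x" "map e vs"]
      Cons.prems(1) len by simp
  moreover have "F (map e pre @ e x # map e us @ map e vs)
      = (- 1) ^ length pre * F (e x # map e pre @ map e us @ map e vs)"
    using alternating_move_to_front[OF ml al, of "map e pre" "e x" "map e us @ map e vs"]
      Cons.prems(1) len by simp
  ultimately have "F (map e ((pre @ [x]) @ sort xs)) = 0" using uv by simp
  then show ?case using Cons.IH[of "pre @ [x]"] Cons.prems(1) by simp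
qed simp

text \<open>Expanding the first argument in the frame reduces the number of arguments by one.\<close>

lemma multilinear_eq_0I:
  assumes fr: "euclidean_frame e m"
  shows "multilinear n F \<Longrightarrow> (\<And>js. length js = n \<Longrightarrow> set js \<subseteq> {..<m} \<Longrightarrow> F (map e js) = 0)
    \<Longrightarrow> length ws = n \<Longrightarrow> F ws = 0"
proof (induction n arbitrary: F ws)
  case (Suc n)
  obtain w us where ws: "ws = w # us" "length us = n" using Suc.prems(3) by (cases ws) auto
  have "F (e j # us) = 0" if "j < m" for j
  proof (rule Suc.IH[OF multilinear_Cons[OF Suc.prems(1)] _ ws(2)])
    fix js assume "length js = n" "set js \<subseteq> {..<m}"
    then show "F (e j # map e js) = 0" using Suc.prems(2)[of "j # js"] that by simp
  qed
  then show ?case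
    using multilinear_expand_first[OF fr Suc.prems(1) ws(2), of w] ws(1) by simp
next
  case 0
  then show ?case using 0(2)[of "[]"] by simp
qed

text \<open>Uniqueness half of the coordinate expansion of alternating forms: by multilinearity only frame
vectors matter, repeated ones give \<open>0\<close>, and distinct ones can be sorted.\<close>

lemma alternating_eq_0I:
  assumes fr: "euclidean_frame e m" and ml: "multilinear n F" and al: "alternating n F"
    and inc: "\<And>I. I \<subseteq> {..<m} \<Longrightarrow> card I = n \<Longrightarrow> F (map e (sorted_list_of_set I)) = 0"
    and len: "length ws = n"
  shows "F ws = 0"
proof (rule multilinear_eq_0I[OF fr ml _ len])
  fix js assume js: "length js = n" "set js \<subseteq> {..<m}"
  show "F (map e js) = 0"
  proof (cases "distinct js")
    case True
    have "sort js = sorted_list_of_set (set js)"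
      using True by (simp add: sorted_list_of_set_sort_remdups distinct_remdups_id)
    moreover have "card (set js) = n" using True js by (simp add: distinct_card)
    ultimately show ?thesis
      using alternating_insort[OF ml al, of "[]" js e] js inc[of "set js"] by simp
  next
    case False
    then obtain i j where "i < length js" "j < length js" "i \<noteq> j" "js ! i = js ! j"
      by (auto simp: distinct_conv_nth)
    then show ?thesis using js(1) by (intro alternatingD[OF al, of _ i j]) auto
  qed
qed

section \<open>Wedge products of covectors\<close>

text \<open>The sum over the inverse permutations, in which every factor involves a fixed argument. This form shows
multilinearity in the arguments.\<close>

lemma wedge_slots:
  "wedge \<theta>s vs = (\<Sum>\<sigma> | \<sigma> permutes {..<length \<theta>s}.
     of_int (sign \<sigma>) * (\<Prod>k<length \<theta>s. (\<theta>s ! \<sigma> k) (vs ! k)))"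
proof -
  let ?P = "{\<sigma>. \<sigma> permutes {..<length \<theta>s}}"
  have "wedge \<theta>s vs = (\<Sum>\<sigma>\<in>?P. of_int (sign (inv \<sigma>)) * (\<Prod>k<length \<theta>s. (\<theta>s ! k) (vs ! inv \<sigma> k)))"
    unfolding wedge_def by (rule sum_permutations_inverse)
  also have "\<dots> = (\<Sum>\<sigma>\<in>?P. of_int (sign \<sigma>) * (\<Prod>k<length \<theta>s. (\<theta>s ! \<sigma> k) (vs ! k)))"
  proof (rule sum.cong[OF refl])
    fix \<sigma> :: "nat \<Rightarrow> nat" assume "\<sigma> \<in> ?P"
    then have \<sigma>: "\<sigma> permutes {..<length \<theta>s}" by simp
    then have "permutation \<sigma>" by (auto simp: permutation_permutes)
    then have "sign (inv \<sigma>) = sign \<sigma>" by (rule sign_inverse)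
    moreover have "(\<Prod>k<length \<theta>s. (\<theta>s ! k) (vs ! inv \<sigma> k)) = (\<Prod>k<length \<theta>s. (\<theta>s ! \<sigma> k) (vs ! k))"
      using prod.permute[OF \<sigma>, of "\<lambda>k. (\<theta>s ! k) (vs ! inv \<sigma> k)"]
      by (simp add: o_def permutes_inverses(2)[OF \<sigma>])
    ultimately show "of_int (sign (inv \<sigma>)) * (\<Prod>k<length \<theta>s. (\<theta>s ! k) (vs ! inv \<sigma> k))
        = of_int (sign \<sigma>) * (\<Prod>k<length \<theta>s. (\<theta>s ! \<sigma> k) (vs ! k))" by simp
  qed
  finally show ?thesis .
qed

lemma multilinear_sum:
  "(\<And>s. s \<in> S \<Longrightarrow> multilinear n (F s)) \<Longrightarrow> multilinear n (\<lambda>ws. \<Sum>s\<in>S. F s ws)"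
  unfolding multilinear_def by (simp add: sum_distrib_left sum.distrib)

lemma multilinear_cmult: "multilinear n F \<Longrightarrow> multilinear n (\<lambda>ws. c * F ws)"
  unfolding multilinear_def by (simp add: algebra_simps)

lemma multilinear_add:
  "multilinear n F \<Longrightarrow> multilinear n G \<Longrightarrow> multilinear n (\<lambda>ws. F ws + G ws)"
  unfolding multilinear_def by (simp add: algebra_simps)

lemma multilinear_diff:
  "multilinear n F \<Longrightarrow> multilinear n G \<Longrightarrow> multilinear n (\<lambda>ws. F ws - G ws)"
  unfolding multilinear_def by (simp add: algebra_simps)

lemma alternating_sum:
  "(\<And>s. s \<in> S \<Longrightarrow> alternating n (F s)) \<Longrightarrow> alternating n (\<lambda>ws. \<Sum>s\<in>S. F s ws)"
  unfolding alternating_def by (blast intro: sum.neutral)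

lemma alternating_cmult: "alternating n F \<Longrightarrow> alternating n (\<lambda>ws. c * F ws)"
  unfolding alternating_def by simp

lemma alternating_add:
  "alternating n F \<Longrightarrow> alternating n G \<Longrightarrow> alternating n (\<lambda>ws. F ws + G ws)"
  unfolding alternating_def by (metis add_0)

lemma alternating_diff:
  "alternating n F \<Longrightarrow> alternating n G \<Longrightarrow> alternating n (\<lambda>ws. F ws - G ws)"
  unfolding alternating_def by (metis diff_0_right)

lemma multilinear_prod:
  assumes "\<And>k. k < n \<Longrightarrow> linear (g k :: 'b::real_vector \<Rightarrow> real)"
  shows "multilinear n (\<lambda>ws. \<Prod>k<n. g k (ws ! k))"
  unfolding multilinear_def
proof (intro allI impI)
  fix ws :: "'b list" and i u w a b
  assume len: "length ws = n" "i < n"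
  have split: "(\<Prod>k<n. g k (ws[i := x] ! k)) = g i x * (\<Prod>k\<in>{..<n} - {i}. g k (ws ! k))" for x
    using len by (subst prod.remove[of _ i]) (auto intro!: prod.cong)
  show "(\<Prod>k<n. g k (ws[i := a *\<^sub>R u + b *\<^sub>R w] ! k))
      = a * (\<Prod>k<n. g k (ws[i := u] ! k)) + b * (\<Prod>k<n. g k (ws[i := w] ! k))"
    unfolding split using assms[OF len(2)]
    by (simp add: linear_add linear_cmul algebra_simps)
qed

lemma multilinear_wedge:
  assumes "\<And>\<theta>. \<theta> \<in> set \<theta>s \<Longrightarrow> linear \<theta>"
  shows "multilinear (length \<theta>s) (wedge \<theta>s)"
  unfolding wedge_slots[abs_def]
proof (intro multilinear_sum multilinear_cmult multilinear_prod)
  fix \<sigma> k assume "\<sigma> \<in> {\<sigma>. \<sigma> permutes {..<length \<theta>s}}" "k < length \<theta>s"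
  then have "\<sigma> k < length \<theta>s" using permutes_in_image[of \<sigma> "{..<length \<theta>s}" k] by simp
  then show "linear (\<theta>s ! \<sigma> k)" using assms by simp
qed

text \<open>Composing all permutations with the transposition of two equal arguments changes the sign of each
summand and nothing else.\<close>

lemma alternating_wedge: "alternating (length \<theta>s) (wedge \<theta>s)"
  unfolding alternating_def
proof (intro allI impI)
  fix vs :: "'a list" and i j
  let ?n = "length \<theta>s"
  assume "length vs = ?n" and ij: "i < ?n" "j < ?n" "i \<noteq> j" and eq: "vs ! i = vs ! j"
  define t where "t = Transposition.transpose i j"
  have t: "t permutes {..<?n}" unfolding t_def using ij by (intro permutes_swap_id) auto
  have vt: "vs ! t k = vs ! k" for k unfolding t_def using eq by (auto simp: Transposition.transpose_def)
  have "wedge \<theta>s vs = (\<Sum>\<sigma> | \<sigma> permutes {..<?n}.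
        of_int (sign (t \<circ> \<sigma>)) * (\<Prod>k<?n. (\<theta>s ! k) (vs ! (t \<circ> \<sigma>) k)))"
    unfolding wedge_def by (rule setum_permutations_compose_left[OF t])
  also have "\<dots> = (\<Sum>\<sigma> | \<sigma> permutes {..<?n}. - (of_int (sign \<sigma>) * (\<Prod>k<?n. (\<theta>s ! k) (vs ! \<sigma> k))))"
  proof (rule sum.cong[OF refl])
    fix \<sigma> assume "\<sigma> \<in> {\<sigma>. \<sigma> permutes {..<?n}}"
    then have "permutation \<sigma>" "permutation t"
      using t by (auto simp: permutation_permutes)
    then have "sign (t \<circ> \<sigma>) = - sign \<sigma>"
      using ij by (simp add: sign_compose t_def sign_swap_id)
    then show "of_int (sign (t \<circ> \<sigma>)) * (\<Prod>k<?n. (\<theta>s ! k) (vs ! (t \<circ> \<sigma>) k))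
        = - (of_int (sign \<sigma>) * (\<Prod>k<?n. (\<theta>s ! k) (vs ! \<sigma> k)))" by (simp add: vt)
  qed
  also have "\<dots> = - wedge \<theta>s vs" by (simp add: wedge_def sum_negf)
  finally show "wedge \<theta>s vs = 0" by simp
qed

text \<open>The determinant of a matrix of Kronecker deltas: a nonzero product matches the two increasing
sequences term by term, which forces the index sets to agree and the permutation to be the identity.\<close>

lemma wedge_increasing_frame:
  assumes fr: "euclidean_frame e m" and I: "I \<subseteq> {..<m}" and J: "J \<subseteq> {..<m}" and card: "card I = card J"
  shows "wedge (map (\<lambda>i v. v \<bullet> e i) (sorted_list_of_set I)) (map e (sorted_list_of_set J))
    = (if I = J then 1 else 0)"
proof -
  define ks js where "ks = sorted_list_of_set I" and "js = sorted_list_of_set J"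
  have fin: "finite I" "finite J" using I J finite_subset by blast+
  have props: "set ks = I" "set js = J" "length ks = card I" "length js = card I" "distinct js"
    using fin card by (simp_all add: ks_def js_def)
  let ?n = "card I"
  have tm: "(\<Prod>k<?n. (map (\<lambda>i v. v \<bullet> e i) ks ! k) (map e js ! \<sigma> k))
      = (if I = J \<and> \<sigma> = id then 1 else 0)" if \<sigma>: "\<sigma> permutes {..<?n}" for \<sigma>
  proof -
    have \<sigma>n: "\<sigma> k < ?n" if "k < ?n" for k
      using permutes_in_image[OF \<sigma>, of k] that by simp
    have "(\<Prod>k<?n. (map (\<lambda>i v. v \<bullet> e i) ks ! k) (map e js ! \<sigma> k))
        = (\<Prod>k<?n. if js ! \<sigma> k = ks ! k then 1 else 0)"
    proof (rule prod.cong[OF refl])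
      fix k assume "k \<in> {..<?n}"
      then have "k < ?n" by simp
      moreover have "ks ! k < m" "js ! \<sigma> k < m"
        using I J props \<sigma>n[OF \<open>k < ?n\<close>] \<open>k < ?n\<close> by (metis lessThan_iff nth_mem subsetD)+
      ultimately show "(map (\<lambda>i v. v \<bullet> e i) ks ! k) (map e js ! \<sigma> k) = (if js ! \<sigma> k = ks ! k then 1 else 0)"
        using props \<sigma>n[of k] by (simp add: frame_inner[OF fr])
    qed
    also have "\<dots> = (if I = J \<and> \<sigma> = id then 1 else 0)"
    proof (cases "\<forall>k<?n. js ! \<sigma> k = ks ! k")
      case True
      have "I \<subseteq> J"
      proof
        fix i assume "i \<in> I"
        then obtain k where "k < ?n" "i = ks ! k" using props by (metis in_set_conv_nth)
        then show "i \<in> J" using True props \<sigma>n by (metis nth_mem)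
      qed
      then have "I = J" using fin card by (simp add: card_subset_eq)
      then have "ks = js" by (simp add: ks_def js_def)
      have "\<sigma> k = k" for k
      proof (cases "k < ?n")
        case T: True
        then show ?thesis using True \<open>ks = js\<close> props \<sigma>n by (metis nth_eq_iff_index_eq)
      next
        case False
        then show ?thesis using \<sigma> by (simp add: permutes_def)
      qed
      then have "\<sigma> = id" by auto
      then show ?thesis using True \<open>I = J\<close> by simp
    next
      case False
      moreover then have "\<not> (I = J \<and> \<sigma> = id)" by (auto simp: ks_def js_def)
      ultimately show ?thesis by (auto intro!: prod_zero)
    qed
    finally show ?thesis .
  qed
  have "wedge (map (\<lambda>i v. v \<bullet> e i) ks) (map e js)
      = (\<Sum>\<sigma> | \<sigma> permutes {..<?n}. if \<sigma> = id then (if I = J then 1 else 0) else 0)"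
    unfolding wedge_def using props tm by (intro sum.cong) auto
  also have "\<dots> = (if I = J then 1 else 0)"
    by (subst sum.delta) (auto simp: finite_permutations permutes_id)
  finally show ?thesis by (simp add: ks_def js_def)
qed

text \<open>An alternating form is the combination of the \<open>dx\<^sup>I\<close> with its values on increasing frames as
coefficients, because both sides agree on those frames.\<close>

lemma alternating_expansion:
  assumes fr: "euclidean_frame e m" and ml: "multilinear n F" and al: "alternating n F"
    and len: "length ws = n"
  shows "F ws = (\<Sum>I | I \<subseteq> {..<m} \<and> card I = n. F (map e (sorted_list_of_set I)) *
      wedge (map (\<lambda>i v. v \<bullet> e i) (sorted_list_of_set I)) ws)"
proof -
  let ?S = "{I. I \<subseteq> {..<m} \<and> card I = n}"
  let ?W = "\<lambda>I. wedge (map (\<lambda>i v. v \<bullet> e i) (sorted_list_of_set I))"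
  define G where "G = (\<lambda>ws. F ws - (\<Sum>I\<in>?S. F (map e (sorted_list_of_set I)) * ?W I ws))"
  have lenI: "length (map (\<lambda>i v. v \<bullet> e i) (sorted_list_of_set I)) = n" if "I \<in> ?S" for I
    using that finite_subset[of I "{..<m}"] by simp
  have lin: "linear (\<lambda>v. v \<bullet> e i)" for i
    by (simp add: bounded_linear.linear bounded_linear_inner_left)
  have "multilinear n (?W I)" "alternating n (?W I)" if "I \<in> ?S" for I
    using multilinear_wedge[of "map (\<lambda>i v. v \<bullet> e i) (sorted_list_of_set I)"]
      alternating_wedge[of "map (\<lambda>i v. v \<bullet> e i) (sorted_list_of_set I)"] lenI[OF that] lin by auto
  then have "multilinear n G" "alternating n G"
    unfolding G_def
    by (intro multilinear_diff multilinear_sum multilinear_cmult ml alternating_diff alternating_sum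
        alternating_cmult al; simp)+
  moreover have "G (map e (sorted_list_of_set J)) = 0" if J: "J \<subseteq> {..<m}" "card J = n" for J
  proof -
    have fin: "finite ?S" by simp
    have "(\<Sum>I\<in>?S. F (map e (sorted_list_of_set I)) * ?W I (map e (sorted_list_of_set J)))
        = (\<Sum>I\<in>?S. if I = J then F (map e (sorted_list_of_set J)) else 0)"
      by (rule sum.cong) (use J in \<open>auto simp: wedge_increasing_frame[OF fr]\<close>)
    also have "\<dots> = F (map e (sorted_list_of_set J))" using J by (simp add: sum.delta[OF fin])
    finally show ?thesis by (simp add: G_def)
  qed
  ultimately have "G ws = 0" using alternating_eq_0I[OF fr] len by blast
  then show ?thesis by (simp add: G_def)
qed

lemma wedge_dx: "length ks = length ws \<Longrightarrow>
    wedge (map (dx e) ks) ws = wedge (map (\<lambda>i v. v \<bullet> e i) ks) (map fst ws)"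
  unfolding wedge_def
proof (intro sum.cong refl arg_cong2[where f = "(*)"] prod.cong, goal_cases)
  case (3 \<sigma> k)
  then have "\<sigma> k < length ws" using permutes_in_image[of \<sigma> "{..<length ws}" k] by auto
  then show ?case using 3 by (simp add: dx_def case_prod_unfold)
qed auto

text \<open>Replacing one covector \<open>dx\<close> by \<open>dv\<close> at a time is the same as replacing one argument \<open>a\<^sub>k\<close> by
\<open>b\<^sub>k\<close> at a time: in the summand of a permutation \<open>\<sigma>\<close>, the covector in place \<open>k\<close> meets the argument
in place \<open>\<sigma> k\<close>.\<close>

lemma wedge_replace_dv:
  assumes len: "length ks = n" "length ws = n"
  shows "(\<Sum>k<n. wedge ((map (dx e) ks)[k := dv e (ks ! k)]) ws)
       = (\<Sum>k<n. wedge (map (\<lambda>i v. v \<bullet> e i) ks) ((map fst ws)[k := snd (ws ! k)]))"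
proof -
  let ?P = "{\<sigma>. \<sigma> permutes {..<n}}"
  let ?L = "\<lambda>\<sigma> k. \<Prod>l<n. ((map (dx e) ks)[k := dv e (ks ! k)] ! l) (ws ! \<sigma> l)"
  let ?R = "\<lambda>\<sigma> k. \<Prod>l<n. (map (\<lambda>i v. v \<bullet> e i) ks ! l) ((map fst ws)[k := snd (ws ! k)] ! \<sigma> l)"
  have tm: "?L \<sigma> k = ?R \<sigma> (\<sigma> k)" if "\<sigma> \<in> ?P" "k < n" for \<sigma> k
  proof (rule prod.cong[OF refl])
    fix l assume "l \<in> {..<n}"
    then have l: "l < n" by simp
    have \<sigma>: "\<sigma> permutes {..<n}" using that by simp
    have "\<sigma> l < n" "\<sigma> k < n" using permutes_in_image[OF \<sigma>] l that by auto
    moreover have "\<sigma> l = \<sigma> k \<longleftrightarrow> l = k" using permutes_inj[OF \<sigma>] by (auto dest: injD)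
    ultimately show "((map (dx e) ks)[k := dv e (ks ! k)] ! l) (ws ! \<sigma> l)
        = (map (\<lambda>i v. v \<bullet> e i) ks ! l) ((map fst ws)[\<sigma> k := snd (ws ! \<sigma> k)] ! \<sigma> l)"
      using len l by (auto simp: nth_list_update dx_def dv_def case_prod_unfold)
  qed
  have "(\<Sum>k<n. wedge ((map (dx e) ks)[k := dv e (ks ! k)]) ws) = (\<Sum>k<n. \<Sum>\<sigma>\<in>?P. of_int (sign \<sigma>) * ?L \<sigma> k)"
    using len by (simp add: wedge_def)
  also have "\<dots> = (\<Sum>\<sigma>\<in>?P. of_int (sign \<sigma>) * (\<Sum>k<n. ?L \<sigma> k))"
    by (subst sum.swap) (simp add: sum_distrib_left)
  also have "\<dots> = (\<Sum>\<sigma>\<in>?P. of_int (sign \<sigma>) * (\<Sum>k<n. ?R \<sigma> k))"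
  proof (rule sum.cong[OF refl], rule arg_cong[where f = "(*) _"])
    fix \<sigma> :: "nat \<Rightarrow> nat" assume \<sigma>: "\<sigma> \<in> ?P"
    have "(\<Sum>k<n. ?L \<sigma> k) = (\<Sum>k<n. ?R \<sigma> (\<sigma> k))" using tm[OF \<sigma>] by (intro sum.cong) auto
    also have "\<dots> = (\<Sum>k<n. ?R \<sigma> k)"
      using sum.permute[of \<sigma> "{..<n}" "?R \<sigma>"] \<sigma> by (simp add: o_def)
    finally show "(\<Sum>k<n. ?L \<sigma> k) = (\<Sum>k<n. ?R \<sigma> k)" .
  qed
  also have "\<dots> = (\<Sum>k<n. \<Sum>\<sigma>\<in>?P. of_int (sign \<sigma>) * ?R \<sigma> k)"
    unfolding sum_distrib_left by (rule sum.swap)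
  also have "\<dots> = (\<Sum>k<n. wedge (map (\<lambda>i v. v \<bullet> e i) ks) ((map fst ws)[k := snd (ws ! k)]))"
    using len by (simp add: wedge_def)
  finally show ?thesis .
qed

section \<open>Calculus of smooth functions\<close>

lemma C_k_on_cong:
  assumes "open S"
  shows "(\<And>x. x \<in> S \<Longrightarrow> f x = g x) \<Longrightarrow> C_k_on k f S \<Longrightarrow> C_k_on k g S"
proof (induction k arbitrary: f g)
  case 0
  then show ?case by (simp cong: continuous_on_cong)
next
  case (Suc k)
  have df: "f differentiable (at x)" if "x \<in> S" for x using Suc.prems(2) that by simp
  have fd: "frechet_derivative f (at x) = frechet_derivative g (at x)" if "x \<in> S" for x
    using frechet_derivative_transform_within_open[OF df[OF that] assms that Suc.prems(1)] .
  have "g differentiable (at x)" if "x \<in> S" for x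
    using has_derivative_transform_within_open[where f = f and g = g, OF _ assms that]
      df[OF that] Suc.prems(1) unfolding differentiable_def by blast
  moreover have "C_k_on k (\<lambda>x. frechet_derivative g (at x) v) S" for v
    by (rule Suc.IH[of "\<lambda>x. frechet_derivative f (at x) v"]) (use Suc.prems(2) fd in auto)
  ultimately show ?case by simp
qed

lemma C_k_on_SucD: "C_k_on (Suc k) f S \<Longrightarrow> C_k_on k f S"
proof (induction k arbitrary: f)
  case 0
  then show ?case
    by (auto intro!: continuous_at_imp_continuous_on differentiable_imp_continuous_within)
qed simp

text \<open>The inductive step for closure properties: it is enough to exhibit a derivative by the usual rules of
differentiation, so that \<open>frechet_derivative\<close> need not be computed on each occasion.\<close>

lemma C_k_on_Suc_derivI:
  assumes S: "open S"
    and "\<And>x. x \<in> S \<Longrightarrow> (f has_derivative f' x) (at x)"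
    and "\<And>v. C_k_on k (\<lambda>x. f' x v) S"
  shows "C_k_on (Suc k) f S"
proof -
  have "frechet_derivative f (at x) = f' x" if "x \<in> S" for x
    using frechet_derivative_at[OF assms(2)[OF that]] by simp
  then have "C_k_on k (\<lambda>x. frechet_derivative f (at x) v) S" for v
    by (intro C_k_on_cong[OF S _ assms(3)]) simp
  then show ?thesis using assms(2) by (auto simp: differentiable_def)
qed

lemma C_k_on_Suc_derivative:
  "C_k_on (Suc k) f S \<Longrightarrow> x \<in> S \<Longrightarrow> (f has_derivative frechet_derivative f (at x)) (at x)"
  by (simp add: frechet_derivative_works)

lemma C_k_on_const: "C_k_on k (\<lambda>x. c) S"
  by (induction k arbitrary: c) auto

lemma C_k_on_bounded_linear:
  assumes "open S" "bounded_linear f"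
  shows "C_k_on k f S"
proof (cases k)
  case 0
  then show ?thesis using linear_continuous_on[OF assms(2)] by simp
next
  case (Suc l)
  show ?thesis unfolding Suc
    by (rule C_k_on_Suc_derivI[OF assms(1) bounded_linear_imp_has_derivative[OF assms(2)] C_k_on_const])
qed

lemma C_k_on_add:
  assumes S: "open S"
  shows "C_k_on k f S \<Longrightarrow> C_k_on k g S \<Longrightarrow> C_k_on k (\<lambda>x. f x + g x) S"
proof (induction k arbitrary: f g)
  case (Suc k)
  show ?case
  proof (rule C_k_on_Suc_derivI[OF S])
    show "((\<lambda>x. f x + g x) has_derivative
        (\<lambda>h. frechet_derivative f (at x) h + frechet_derivative g (at x) h)) (at x)" if "x \<in> S" for x
      by (intro has_derivative_add C_k_on_Suc_derivative[OF Suc.prems(1) that]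
          C_k_on_Suc_derivative[OF Suc.prems(2) that])
    show "C_k_on k (\<lambda>x. frechet_derivative f (at x) v + frechet_derivative g (at x) v) S" for v
      using Suc.prems by (intro Suc.IH) auto
  qed
qed (auto intro: continuous_on_add)

lemma C_k_on_scaleR:
  fixes f :: "'b::real_normed_vector \<Rightarrow> real"
  assumes S: "open S"
  shows "C_k_on k f S \<Longrightarrow> C_k_on k g S \<Longrightarrow> C_k_on k (\<lambda>x. f x *\<^sub>R g x) S"
proof (induction k arbitrary: f g)
  case (Suc k)
  show ?case
  proof (rule C_k_on_Suc_derivI[OF S])
    show "((\<lambda>x. f x *\<^sub>R g x) has_derivative
        (\<lambda>h. f x *\<^sub>R frechet_derivative g (at x) h + frechet_derivative f (at x) h *\<^sub>R g x)) (at x)"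
      if "x \<in> S" for x
      by (intro has_derivative_scaleR C_k_on_Suc_derivative[OF Suc.prems(1) that]
          C_k_on_Suc_derivative[OF Suc.prems(2) that])
    show "C_k_on k (\<lambda>x. f x *\<^sub>R frechet_derivative g (at x) v + frechet_derivative f (at x) v *\<^sub>R g x) S"
      for v
      using Suc.prems Suc.prems[THEN C_k_on_SucD] by (intro C_k_on_add[OF S] Suc.IH) auto
  qed
qed (auto intro: continuous_on_scaleR)

lemma C_k_on_compose_fst:
  fixes f :: "'b::real_normed_vector \<Rightarrow> 'c::real_normed_vector"
  assumes S: "open S"
  shows "C_k_on k f S \<Longrightarrow> C_k_on k (\<lambda>z::'b \<times> 'd::real_normed_vector. f (fst z)) (S \<times> UNIV)"
proof (induction k arbitrary: f)
  case 0
  then have "continuous_on S f" by simp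
  then show ?case by (auto intro!: continuous_on_compose2[of S f] continuous_intros)
next
  case (Suc k)
  show ?case
  proof (rule C_k_on_Suc_derivI[OF open_Times[OF S open_UNIV]])
    fix z :: "'b \<times> 'd" assume "z \<in> S \<times> UNIV"
    then have "(f has_derivative frechet_derivative f (at (fst z))) (at (fst z))"
      by (intro C_k_on_Suc_derivative[OF Suc.prems]) auto
    then show "((\<lambda>z. f (fst z)) has_derivative (\<lambda>h. frechet_derivative f (at (fst z)) (fst h))) (at z)"
      using diff_chain_at[OF bounded_linear_imp_has_derivative[OF bounded_linear_fst]]
      by (simp add: o_def)
  next
    show "C_k_on k (\<lambda>z::'b \<times> 'd. frechet_derivative f (at (fst z)) (fst v)) (S \<times> UNIV)" for v :: "'b \<times> 'd"
      using Suc.IH[of "\<lambda>x. frechet_derivative f (at x) (fst v)"] Suc.prems by simp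
  qed
qed

lemma C_k_on_exp_fst:
  assumes S: "open S"
  shows "C_k_on k (\<lambda>z::real \<times> 'd::real_normed_vector. exp (fst z) * c) S"
proof (induction k arbitrary: c)
  case (Suc k)
  show ?case
  proof (rule C_k_on_Suc_derivI[OF S])
    show "((\<lambda>z. exp (fst z) * c) has_derivative (\<lambda>h. exp (fst z) * (fst h * c))) (at z)" for z :: "real \<times> 'd"
      by (auto intro!: derivative_eq_intros simp: algebra_simps)
    show "C_k_on k (\<lambda>z. exp (fst z) * (fst v * c)) S" for v :: "real \<times> 'd"
      by (rule Suc.IH)
  qed
qed (auto intro!: continuous_intros)

lemma smooth_on_cong:
  "open S \<Longrightarrow> smooth_on f S \<Longrightarrow> (\<And>x. x \<in> S \<Longrightarrow> f x = g x) \<Longrightarrow> smooth_on g S"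
  unfolding smooth_on_def using C_k_on_cong[of S f g] by blast

lemma smooth_on_const: "smooth_on (\<lambda>x. c) S"
  by (simp add: smooth_on_def C_k_on_const)

lemma smooth_on_bounded_linear: "open S \<Longrightarrow> bounded_linear f \<Longrightarrow> smooth_on f S"
  by (simp add: smooth_on_def C_k_on_bounded_linear)

lemma smooth_on_add: "open S \<Longrightarrow> smooth_on f S \<Longrightarrow> smooth_on g S \<Longrightarrow> smooth_on (\<lambda>x. f x + g x) S"
  by (simp add: smooth_on_def C_k_on_add)

lemma smooth_on_scaleR:
  "open S \<Longrightarrow> smooth_on f S \<Longrightarrow> smooth_on g S \<Longrightarrow> smooth_on (\<lambda>x. f x *\<^sub>R g x) S"
  by (simp add: smooth_on_def C_k_on_scaleR)

lemma smooth_on_mult: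
  fixes f g :: "'b::real_normed_vector \<Rightarrow> real"
  shows "open S \<Longrightarrow> smooth_on f S \<Longrightarrow> smooth_on g S \<Longrightarrow> smooth_on (\<lambda>x. f x * g x) S"
  using smooth_on_scaleR[of S f g] by simp

lemma smooth_on_diff:
  fixes f g :: "'b::real_normed_vector \<Rightarrow> real"
  assumes "open S" "smooth_on f S" "smooth_on g S"
  shows "smooth_on (\<lambda>x. f x - g x) S"
  using smooth_on_add[OF assms(1,2) smooth_on_mult[OF assms(1) smooth_on_const assms(3)], of "-1"]
  by simp

lemma smooth_on_sum:
  "open S \<Longrightarrow> (\<And>i. i \<in> I \<Longrightarrow> smooth_on (f i) S) \<Longrightarrow> smooth_on (\<lambda>x. \<Sum>i\<in>I. f i x) S"
  by (induction I rule: infinite_finite_induct) (auto intro!: smooth_on_const smooth_on_add)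

lemma smooth_on_compose_fst:
  "open S \<Longrightarrow> smooth_on f S \<Longrightarrow> smooth_on (\<lambda>z. f (fst z)) (S \<times> UNIV)"
  by (simp add: smooth_on_def C_k_on_compose_fst)

lemma smooth_on_derivative:
  "smooth_on f S \<Longrightarrow> smooth_on (\<lambda>x. frechet_derivative f (at x) v) S"
  unfolding smooth_on_def by (metis C_k_on.simps(2))

lemma smooth_on_differentiable: "smooth_on f S \<Longrightarrow> x \<in> S \<Longrightarrow> f differentiable (at x)"
  unfolding smooth_on_def by (metis C_k_on.simps(2))

lemma smooth_on_C2: "smooth_on f S \<Longrightarrow> C_k_on (Suc (Suc 0)) f S"
  unfolding smooth_on_def by blast

section \<open>Symmetry of second derivatives\<close>

lemma has_real_derivative_along_line:
  fixes f :: "'b::real_normed_vector \<Rightarrow> real"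
  assumes "f differentiable (at (a + s *\<^sub>R u))"
  shows "((\<lambda>s. f (a + s *\<^sub>R u)) has_real_derivative frechet_derivative f (at (a + s *\<^sub>R u)) u) (at s)"
proof -
  let ?D = "frechet_derivative f (at (a + s *\<^sub>R u))"
  have "((\<lambda>s. a + s *\<^sub>R u) has_derivative (\<lambda>h. h *\<^sub>R u)) (at s)"
    by (auto intro!: derivative_eq_intros)
  then have "((\<lambda>s. f (a + s *\<^sub>R u)) has_derivative (\<lambda>h. ?D (h *\<^sub>R u))) (at s)"
    using diff_chain_at[of "\<lambda>s. a + s *\<^sub>R u" _ s f ?D] assms
    by (simp add: frechet_derivative_works o_def)
  moreover have "?D (h *\<^sub>R u) = ?D u * h" for h
    using linear_frechet_derivative[OF assms] by (simp add: linear_cmul)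
  ultimately show ?thesis by (simp add: has_field_derivative_def)
qed

text \<open>The mean value theorem applied twice: to \<open>s \<mapsto> f (x + s u + h w) - f (x + s u)\<close> and then to the
derivative in direction \<open>u\<close> along \<open>w\<close>.\<close>

lemma second_difference_mean_value:
  fixes f :: "'b::real_normed_vector \<Rightarrow> real"
  assumes C2: "C_k_on (Suc (Suc 0)) f S" and h: "h > 0"
    and inS: "\<And>s t. 0 \<le> s \<Longrightarrow> s \<le> h \<Longrightarrow> 0 \<le> t \<Longrightarrow> t \<le> h \<Longrightarrow> x + s *\<^sub>R u + t *\<^sub>R w \<in> S"
  obtains s t where "0 < s" "s < h" "0 < t" "t < h"
    "f (x + h *\<^sub>R u + h *\<^sub>R w) - f (x + h *\<^sub>R u) - f (x + h *\<^sub>R w) + f x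
      = h * (h * frechet_derivative (\<lambda>z. frechet_derivative f (at z) u) (at (x + s *\<^sub>R u + t *\<^sub>R w)) w)"
proof -
  let ?Du = "\<lambda>z. frechet_derivative f (at z) u"
  have d1: "f differentiable (at z)" and d2: "?Du differentiable (at z)" if "z \<in> S" for z
    using C2 that by auto
  have "\<exists>s. 0 < s \<and> s < h \<and>
      (f ((x + h *\<^sub>R w) + h *\<^sub>R u) - f (x + h *\<^sub>R u)) - (f ((x + h *\<^sub>R w) + 0 *\<^sub>R u) - f (x + 0 *\<^sub>R u))
      = (h - 0) * (?Du ((x + h *\<^sub>R w) + s *\<^sub>R u) - ?Du (x + s *\<^sub>R u))"
  proof (rule MVT2[OF h])
    fix s assume s: "0 \<le> s" "s \<le> h"
    have "(x + h *\<^sub>R w) + s *\<^sub>R u \<in> S" "x + s *\<^sub>R u \<in> S"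
      using inS[OF s, of h] inS[OF s, of 0] h by (simp_all add: algebra_simps)
    then show "((\<lambda>s. f ((x + h *\<^sub>R w) + s *\<^sub>R u) - f (x + s *\<^sub>R u)) has_real_derivative
        (?Du ((x + h *\<^sub>R w) + s *\<^sub>R u) - ?Du (x + s *\<^sub>R u))) (at s)"
      by (intro DERIV_diff has_real_derivative_along_line d1)
  qed
  then obtain s where s: "0 < s" "s < h" and eq1:
      "f (x + h *\<^sub>R u + h *\<^sub>R w) - f (x + h *\<^sub>R u) - f (x + h *\<^sub>R w) + f x
      = h * (?Du (x + s *\<^sub>R u + h *\<^sub>R w) - ?Du (x + s *\<^sub>R u))"
    by (auto simp: algebra_simps)
  have "\<exists>t. 0 < t \<and> t < h \<and> ?Du (x + s *\<^sub>R u + h *\<^sub>R w) - ?Du (x + s *\<^sub>R u + 0 *\<^sub>R w)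
      = (h - 0) * frechet_derivative ?Du (at (x + s *\<^sub>R u + t *\<^sub>R w)) w"
    by (rule MVT2[OF h]) (intro has_real_derivative_along_line d2 inS; use s in simp)
  then obtain t where t: "0 < t" "t < h" and eq2:
      "?Du (x + s *\<^sub>R u + h *\<^sub>R w) - ?Du (x + s *\<^sub>R u)
      = h * frechet_derivative ?Du (at (x + s *\<^sub>R u + t *\<^sub>R w)) w" by auto
  show ?thesis using that[OF s t] eq1 eq2 by simp
qed

text \<open>The second difference is symmetric in \<open>u\<close> and \<open>w\<close>, so the two mixed derivatives agree at two points
arbitrarily close to \<open>x\<close>; if they differed at \<open>x\<close>, continuity would separate them.\<close>

lemma second_derivative_symmetric_real:
  fixes f :: "'b::real_normed_vector \<Rightarrow> real"
  assumes S: "open S" and C2: "C_k_on (Suc (Suc 0)) f S" and x: "x \<in> S"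
  shows "frechet_derivative (\<lambda>z. frechet_derivative f (at z) u) (at x) w
       = frechet_derivative (\<lambda>z. frechet_derivative f (at z) w) (at x) u"
proof (rule ccontr)
  let ?A = "\<lambda>z. frechet_derivative (\<lambda>z. frechet_derivative f (at z) u) (at z) w"
  let ?B = "\<lambda>z. frechet_derivative (\<lambda>z. frechet_derivative f (at z) w) (at z) u"
  assume ne: "?A x \<noteq> ?B x"
  have "continuous_on S (\<lambda>z. ?A z - ?B z)" using C2 by (intro continuous_on_diff) auto
  then have "isCont (\<lambda>z. ?A z - ?B z) x" using S x by (simp add: continuous_on_eq_continuous_at)
  then have cA: "isCont ?A x" and cB: "isCont ?B x"
    using C2 S x by (auto simp: continuous_on_eq_continuous_at)
  define \<epsilon> where "\<epsilon> = \<bar>?A x - ?B x\<bar> / 2"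
  have \<epsilon>: "\<epsilon> > 0" using ne by (simp add: \<epsilon>_def)
  obtain d1 where d1: "d1 > 0" "\<And>z. dist z x < d1 \<Longrightarrow> dist (?A z) (?A x) < \<epsilon>"
    using cA \<epsilon> unfolding continuous_at_eps_delta dist_norm by (metis dist_norm)
  obtain d2 where d2: "d2 > 0" "\<And>z. dist z x < d2 \<Longrightarrow> dist (?B z) (?B x) < \<epsilon>"
    using cB \<epsilon> unfolding continuous_at_eps_delta dist_norm by (metis dist_norm)
  obtain d3 where d3: "d3 > 0" "\<And>z. dist z x < d3 \<Longrightarrow> z \<in> S"
    using S x by (meson open_dist)
  define d where "d = min d1 (min d2 d3)"
  have d: "d > 0" using d1 d2 d3 by (simp add: d_def)
  \<comment> \<open>The summand 1 keeps the denominator positive when both directions are 0.\<close>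
  define N where "N = norm u + norm w + 1"
  define h where "h = d / (2 * N)"
  have pos: "N > 0" by (simp add: N_def add_nonneg_pos)
  have h: "h > 0" unfolding h_def using d pos by simp
  have hd: "h * (norm u + norm w) < d"
  proof -
    have "h * (norm u + norm w) \<le> h * N" using h by (simp add: N_def)
    also have "\<dots> = d / 2" using pos by (simp add: h_def)
    finally show ?thesis using d by simp
  qed
  have near: "dist (x + s *\<^sub>R a + t *\<^sub>R b) x < d"
    if "0 \<le> s" "s \<le> h" "0 \<le> t" "t \<le> h" "a = u \<and> b = w \<or> a = w \<and> b = u" for s t a b
  proof -
    have "dist (x + s *\<^sub>R a + t *\<^sub>R b) x = norm (s *\<^sub>R a + t *\<^sub>R b)" by (simp add: dist_norm)
    also have "\<dots> \<le> s * norm a + t * norm b"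
      using norm_triangle_ineq[of "s *\<^sub>R a" "t *\<^sub>R b"] that by simp
    also have "\<dots> \<le> h * norm a + h * norm b"
      using that by (intro add_mono mult_right_mono) auto
    also have "\<dots> < d" using hd that(5) by (auto simp: algebra_simps)
    finally show ?thesis .
  qed
  have inS: "x + s *\<^sub>R a + t *\<^sub>R b \<in> S"
    if "0 \<le> s" "s \<le> h" "0 \<le> t" "t \<le> h" "a = u \<and> b = w \<or> a = w \<and> b = u" for s t a b
    using d3(2) near[OF that] by (simp add: d_def)
  obtain s t where st: "0 < s" "s < h" "0 < t" "t < h"
    "f (x + h *\<^sub>R u + h *\<^sub>R w) - f (x + h *\<^sub>R u) - f (x + h *\<^sub>R w) + f x
      = h * (h * ?A (x + s *\<^sub>R u + t *\<^sub>R w))"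
    by (rule second_difference_mean_value[OF C2 h, of x u w]) (use inS in auto)
  obtain s' t' where st': "0 < s'" "s' < h" "0 < t'" "t' < h"
    "f (x + h *\<^sub>R w + h *\<^sub>R u) - f (x + h *\<^sub>R w) - f (x + h *\<^sub>R u) + f x
      = h * (h * ?B (x + s' *\<^sub>R w + t' *\<^sub>R u))"
    by (rule second_difference_mean_value[OF C2 h, of x w u]) (use inS in auto)
  have "h * (h * ?A (x + s *\<^sub>R u + t *\<^sub>R w)) = h * (h * ?B (x + s' *\<^sub>R w + t' *\<^sub>R u))"
    using st(5) st'(5) by (simp add: algebra_simps)
  then have "?A (x + s *\<^sub>R u + t *\<^sub>R w) = ?B (x + s' *\<^sub>R w + t' *\<^sub>R u)" using h by simp
  moreover have "dist (?A (x + s *\<^sub>R u + t *\<^sub>R w)) (?A x) < \<epsilon>"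
    using d1(2) near[of s t u w] st by (simp add: d_def)
  moreover have "dist (?B (x + s' *\<^sub>R w + t' *\<^sub>R u)) (?B x) < \<epsilon>"
    using d2(2) near[of s' t' w u] st' by (simp add: d_def)
  moreover have False if "a = b" "dist a a' < \<bar>a' - b'\<bar> / 2" "dist b b' < \<bar>a' - b'\<bar> / 2"
    for a b a' b' :: real
    using that dist_triangle_half_l[of a' a "\<bar>a' - b'\<bar>" b'] by (simp add: dist_real_def dist_commute abs_minus_commute)
  ultimately show False unfolding \<epsilon>_def by blast
qed

text \<open>Reduction to real values: pair the map with the difference of the two sides, whose inner product with
itself then vanishes. This works without coordinates on the target.\<close>

lemma second_derivative_symmetric:
  fixes \<tau> :: "'b::real_normed_vector \<Rightarrow> 'c::real_inner"
  assumes S: "open S" and C2: "C_k_on (Suc (Suc 0)) \<tau> S" and x: "x \<in> S"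
  shows "frechet_derivative (\<lambda>z. frechet_derivative \<tau> (at z) u) (at x) w
       = frechet_derivative (\<lambda>z. frechet_derivative \<tau> (at z) w) (at x) u" (is "?L = ?R")
proof -
  define f where "f = (\<lambda>z. \<tau> z \<bullet> (?L - ?R))"
  let ?D = "\<lambda>v z. frechet_derivative \<tau> (at z) v"
  have fd: "(f has_derivative (\<lambda>h. ?D h z \<bullet> (?L - ?R))) (at z)" if "z \<in> S" for z
    unfolding f_def by (intro has_derivative_inner_left C_k_on_Suc_derivative[OF C2 that])
  have C1: "C_k_on (Suc 0) (?D v) S" for v using C2 by simp
  have fd2: "((\<lambda>z. ?D v z \<bullet> (?L - ?R)) has_derivative
      (\<lambda>h. frechet_derivative (?D v) (at z) h \<bullet> (?L - ?R))) (at z)" if "z \<in> S" for z v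
    by (intro has_derivative_inner_left C_k_on_Suc_derivative[OF C1 that])
  have C2f: "C_k_on (Suc (Suc 0)) f S"
  proof (intro C_k_on_Suc_derivI[OF S fd] C_k_on_Suc_derivI[OF S fd2])
    fix v v'
    have "continuous_on S (\<lambda>z. frechet_derivative (?D v) (at z) v')" using C1 by simp
    then show "C_k_on 0 (\<lambda>z. frechet_derivative (?D v) (at z) v' \<bullet> (?L - ?R)) S"
      by (auto intro!: continuous_intros)
  qed
  have "frechet_derivative (\<lambda>z. frechet_derivative f (at z) v) (at x)
      = (\<lambda>h. frechet_derivative (?D v) (at x) h \<bullet> (?L - ?R))" for v
  proof (rule frechet_derivative_at[symmetric])
    show "((\<lambda>z. frechet_derivative f (at z) v) has_derivative
        (\<lambda>h. frechet_derivative (?D v) (at x) h \<bullet> (?L - ?R))) (at x)"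
      by (rule has_derivative_transform_within_open[OF fd2[OF x] S x])
         (simp add: frechet_derivative_at[OF fd, symmetric])
  qed
  then have "?L \<bullet> (?L - ?R) = ?R \<bullet> (?L - ?R)"
    using second_derivative_symmetric_real[OF S C2f x, of u w] by simp
  then have "(?L - ?R) \<bullet> (?L - ?R) = 0" by (simp add: inner_diff_left)
  then show ?thesis by simp
qed

section \<open>The lift and the exterior derivative in coordinates\<close>

text \<open>The product rule for a form whose base point and arguments all depend on a parameter. The form is only
assumed differentiable for constant arguments; joint differentiability comes from expanding the first
argument in the frame and inducting on the degree.\<close>

lemma has_derivative_multilinear:
  fixes \<tau> :: "'x::real_normed_vector \<Rightarrow> 'b::real_normed_vector" and e :: "nat \<Rightarrow> 'e::real_inner"
    and F :: "'b \<Rightarrow> 'e list \<Rightarrow> real"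
  assumes fr: "euclidean_frame e m" and \<tau>: "(\<tau> has_derivative \<tau>') (at y)"
    and S: "open S" "\<tau> y \<in> S"
  shows "length vs = n \<Longrightarrow> length dvs = n \<Longrightarrow>
    (\<And>k. k < n \<Longrightarrow> ((vs ! k) has_derivative (dvs ! k)) (at y)) \<Longrightarrow>
    (\<And>z. z \<in> S \<Longrightarrow> multilinear n (F z)) \<Longrightarrow>
    (\<And>ws. length ws = n \<Longrightarrow> (\<lambda>z. F z ws) differentiable (at (\<tau> y))) \<Longrightarrow>
    ((\<lambda>x. F (\<tau> x) (map (\<lambda>v. v x) vs)) has_derivative
     (\<lambda>h. frechet_derivative (\<lambda>z. F z (map (\<lambda>v. v y) vs)) (at (\<tau> y)) (\<tau>' h)
        + (\<Sum>k<n. F (\<tau> y) ((map (\<lambda>v. v y) vs)[k := (dvs ! k) h])))) (at y)"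
proof (induction n arbitrary: vs dvs F)
  case 0
  have "((\<lambda>z. F z []) has_derivative frechet_derivative (\<lambda>z. F z []) (at (\<tau> y))) (at (\<tau> y))"
    using 0(5)[of "[]"] by (simp add: frechet_derivative_works)
  from diff_chain_at[OF \<tau> this] show ?case using 0(1) by (simp add: o_def)
next
  case (Suc n)
  obtain v us where vs: "vs = v # us" "length us = n" using Suc.prems(1) by (cases vs) auto
  obtain dv' dus where dvs: "dvs = dv' # dus" "length dus = n" using Suc.prems(2) by (cases dvs) auto
  define rest where "rest = (\<lambda>x. map (\<lambda>v. v x) us)"
  have len: "length (rest x) = n" for x by (simp add: rest_def vs)
  have dv: "(v has_derivative dv') (at y)" using Suc.prems(3)[of 0] vs dvs by simp
  have expand: "F z (a # ws) = (\<Sum>j<m. (a \<bullet> e j) * F z (e j # ws))"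
    if "z \<in> S" "length ws = n" for z a ws
    by (rule multilinear_expand_first[OF fr Suc.prems(4)[OF that(1)] that(2)])
  let ?D = "\<lambda>j. frechet_derivative (\<lambda>z. F z (e j # rest y)) (at (\<tau> y))"
  let ?S = "\<lambda>a h. \<Sum>k<n. F (\<tau> y) (a # (rest y)[k := (dus ! k) h])"
  have IH: "((\<lambda>x. F (\<tau> x) (e j # rest x)) has_derivative (\<lambda>h. ?D j (\<tau>' h) + ?S (e j) h)) (at y)" for j
    unfolding rest_def
  proof (rule Suc.IH[of us dus "\<lambda>z ws. F z (e j # ws)"])
    show "((us ! k) has_derivative (dus ! k)) (at y)" if "k < n" for k
      using Suc.prems(3)[of "Suc k"] that vs dvs by simp
    show "multilinear n (\<lambda>ws. F z (e j # ws))" if "z \<in> S" for z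
      by (rule multilinear_Cons[OF Suc.prems(4)[OF that]])
    show "(\<lambda>z. F z (e j # ws)) differentiable at (\<tau> y)" if "length ws = n" for ws
      using Suc.prems(5)[of "e j # ws"] that by simp
  qed (use vs dvs in auto)
  have "((\<lambda>z. \<Sum>j<m. (v y \<bullet> e j) * F z (e j # rest y)) has_derivative
      (\<lambda>h. \<Sum>j<m. (v y \<bullet> e j) * ?D j h)) (at (\<tau> y))"
    by (intro has_derivative_sum has_derivative_mult_right)
       (simp add: frechet_derivative_works[symmetric] Suc.prems(5) len)
  then have "((\<lambda>z. F z (v y # rest y)) has_derivative (\<lambda>h. \<Sum>j<m. (v y \<bullet> e j) * ?D j h)) (at (\<tau> y))"
    by (rule has_derivative_transform_within_open[OF _ S]) (simp add: expand len)
  then have D: "frechet_derivative (\<lambda>z. F z (v y # rest y)) (at (\<tau> y)) = (\<lambda>h. \<Sum>j<m. (v y \<bullet> e j) * ?D j h)"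
    by (rule frechet_derivative_at[symmetric])
  have "((\<lambda>x. \<Sum>j<m. (v x \<bullet> e j) * F (\<tau> x) (e j # rest x)) has_derivative
      (\<lambda>h. \<Sum>j<m. (v y \<bullet> e j) * (?D j (\<tau>' h) + ?S (e j) h) + (dv' h \<bullet> e j) * F (\<tau> y) (e j # rest y))) (at y)"
    by (intro has_derivative_sum has_derivative_mult has_derivative_inner_left dv IH)
  moreover have "(\<Sum>j<m. (v y \<bullet> e j) * (?D j (\<tau>' h) + ?S (e j) h) + (dv' h \<bullet> e j) * F (\<tau> y) (e j # rest y))
      = frechet_derivative (\<lambda>z. F z (map (\<lambda>v. v y) vs)) (at (\<tau> y)) (\<tau>' h)
        + (\<Sum>k<Suc n. F (\<tau> y) ((map (\<lambda>v. v y) vs)[k := (dvs ! k) h]))" for h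
  proof -
    have "?S (v y) h = (\<Sum>k<n. \<Sum>j<m. (v y \<bullet> e j) * F (\<tau> y) (e j # (rest y)[k := (dus ! k) h]))"
      by (intro sum.cong refl expand S(2)) (simp add: len)
    also have "\<dots> = (\<Sum>j<m. (v y \<bullet> e j) * ?S (e j) h)"
      unfolding sum_distrib_left by (rule sum.swap)
    finally have "?S (v y) h = (\<Sum>j<m. (v y \<bullet> e j) * ?S (e j) h)" .
    moreover have "F (\<tau> y) (dv' h # rest y) = (\<Sum>j<m. (dv' h \<bullet> e j) * F (\<tau> y) (e j # rest y))"
      by (intro expand S(2) len)
    moreover have "map (\<lambda>v. v y) vs = v y # rest y" by (simp add: vs rest_def)
    moreover have "(\<Sum>k<Suc n. F (\<tau> y) ((v y # rest y)[k := (dvs ! k) h])) = F (\<tau> y) (dv' h # rest y) + ?S (v y) h"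
      unfolding sum.lessThan_Suc_shift by (simp add: dvs)
    ultimately show ?thesis by (simp add: D sum.distrib distrib_left)
  qed
  ultimately have step: "((\<lambda>x. \<Sum>j<m. (v x \<bullet> e j) * F (\<tau> x) (e j # rest x)) has_derivative
      (\<lambda>h. frechet_derivative (\<lambda>z. F z (map (\<lambda>v. v y) vs)) (at (\<tau> y)) (\<tau>' h)
        + (\<Sum>k<Suc n. F (\<tau> y) ((map (\<lambda>v. v y) vs)[k := (dvs ! k) h])))) (at y)" by simp
  have "(\<tau> \<longlongrightarrow> \<tau> y) (at y)"
    using has_derivative_continuous[OF \<tau>] by (simp add: continuous_within)
  then have "\<forall>\<^sub>F x in at y. \<tau> x \<in> S" using S by (auto dest: topological_tendstoD)
  then have "\<forall>\<^sub>F x in at y. (\<Sum>j<m. (v x \<bullet> e j) * F (\<tau> x) (e j # rest x)) = F (\<tau> x) (map (\<lambda>v. v x) vs)"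
    by eventually_elim (simp add: expand[symmetric] len vs rest_def)
  moreover have "(\<Sum>j<m. (v y \<bullet> e j) * F (\<tau> y) (e j # rest y)) = F (\<tau> y) (map (\<lambda>v. v y) vs)"
    using S by (simp add: expand[symmetric] len vs rest_def)
  ultimately show ?case
    by (intro has_derivative_transform_eventually[OF step]) auto
qed

text \<open>The coordinate expression of a form of degree \<open>p\<close> on an open subset of the model space.\<close>

definition form_on :: "'b::real_normed_vector set \<Rightarrow> nat \<Rightarrow> ('b \<Rightarrow> 'b list \<Rightarrow> real) \<Rightarrow> bool" where
  "form_on S p f \<longleftrightarrow> (\<forall>y\<in>S. multilinear p (f y) \<and> alternating p (f y)) \<and>
     (\<forall>ws. smooth_on (\<lambda>y. f y ws) S)"

text \<open>The derivative at \<open>t = 0\<close> of \<open>f (y + t u; a\<^sub>1 + t b\<^sub>1, \<dots>, a\<^sub>p + t b\<^sub>p)\<close>, where the \<open>k\<close>-th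
argument is \<open>(a\<^sub>k, b\<^sub>k)\<close>, expanded by the product rule. It involves no frame.\<close>

definition intrinsic_lift ::
  "('b::real_normed_vector \<Rightarrow> 'b list \<Rightarrow> real) \<Rightarrow> 'b \<times> 'b \<Rightarrow> ('b \<times> 'b) list \<Rightarrow> real" where
  "intrinsic_lift f = (\<lambda>(y, u) ws. frechet_derivative (\<lambda>z. f z (map fst ws)) (at y) u
     + (\<Sum>k<length ws. f y ((map fst ws)[k := snd (ws ! k)])))"

lemma form_on_differentiable: "form_on S p f \<Longrightarrow> y \<in> S \<Longrightarrow> (\<lambda>z. f z ws) differentiable (at y)"
  unfolding form_on_def using smooth_on_differentiable by blast

lemma form_on_derivative:
  "form_on S p f \<Longrightarrow> y \<in> S \<Longrightarrow>
    ((\<lambda>z. f z ws) has_derivative frechet_derivative (\<lambda>z. f z ws) (at y)) (at y)"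
  using form_on_differentiable by (simp add: frechet_derivative_works[symmetric])

text \<open>Both terms of the lift follow from the expansion of \<open>f\<close> in the \<open>dx\<^sup>I\<close>: the first by differentiating
the coefficients in direction \<open>u\<close>, the second by \<open>wedge_replace_dv\<close>.\<close>

lemma local_complete_lift_eq_intrinsic_lift:
  fixes e :: "nat \<Rightarrow> 'e::real_inner"
  assumes fr: "euclidean_frame e m" and S: "open S" and f: "form_on S n f" and y: "y \<in> S"
    and len: "length ws = n"
  shows "local_complete_lift e m f (y, u) ws = intrinsic_lift f (y, u) ws"
proof -
  let ?S = "{I. I \<subseteq> {..<m} \<and> card I = n}"
  define l where "l = (\<lambda>I::nat set. sorted_list_of_set I)"
  define c where "c = (\<lambda>I z. f z (map e (l I)))"
  define W where "W = (\<lambda>I. wedge (map (\<lambda>i v. v \<bullet> e i) (l I)))"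
  have lenl: "length (l I) = n" if "I \<in> ?S" for I
    using that finite_subset[of I "{..<m}"] by (simp add: l_def)
  have expand: "f z as = (\<Sum>I\<in>?S. c I z * W I as)" if "z \<in> S" "length as = n" for z as
    unfolding c_def W_def l_def
    using f that by (intro alternating_expansion[OF fr]) (auto simp: form_on_def)
  let ?D = "\<lambda>I. frechet_derivative (c I) (at y)"
  have dc: "(c I has_derivative ?D I) (at y)" for I
    unfolding c_def by (rule form_on_derivative[OF f y])
  have "((\<lambda>z. \<Sum>I\<in>?S. c I z * W I (map fst ws)) has_derivative (\<lambda>h. \<Sum>I\<in>?S. ?D I h * W I (map fst ws))) (at y)"
    by (intro has_derivative_sum has_derivative_mult_left dc)
  then have "((\<lambda>z. f z (map fst ws)) has_derivative (\<lambda>h. \<Sum>I\<in>?S. ?D I h * W I (map fst ws))) (at y)"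
    by (rule has_derivative_transform_within_open[OF _ S y]) (simp add: expand len)
  then have D: "frechet_derivative (\<lambda>z. f z (map fst ws)) (at y) u = (\<Sum>I\<in>?S. ?D I u * W I (map fst ws))"
    by (simp add: frechet_derivative_at[symmetric])
  have Du: "(\<Sum>j<m. (u \<bullet> e j) * ?D I (e j)) = ?D I u" for I
    using linear_frame_expansion[OF fr has_derivative_linear[OF dc[of I]], of u] by simp
  have "local_complete_lift e m f (y, u) ws
      = (\<Sum>I\<in>?S. (\<Sum>j<m. (u \<bullet> e j) * ?D I (e j)) * wedge (map (dx e) (l I)) ws
          + c I y * (\<Sum>k<length (l I). wedge ((map (dx e) (l I))[k := dv e (l I ! k)]) ws))"
    by (simp add: local_complete_lift_def Let_def l_def c_def[abs_def] len)
  also have "\<dots> = (\<Sum>I\<in>?S. ?D I u * W I (map fst ws)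
          + c I y * (\<Sum>k<n. W I ((map fst ws)[k := snd (ws ! k)])))"
    by (intro sum.cong refl)
       (simp add: Du wedge_dx wedge_replace_dv[OF lenl len] len lenl W_def)
  also have "\<dots> = (\<Sum>I\<in>?S. ?D I u * W I (map fst ws))
      + (\<Sum>k<n. \<Sum>I\<in>?S. c I y * W I ((map fst ws)[k := snd (ws ! k)]))"
    unfolding sum.distrib sum_distrib_left by (intro arg_cong2[where f = "(+)"] refl sum.swap)
  also have "\<dots> = intrinsic_lift f (y, u) ws"
    using y len by (simp add: intrinsic_lift_def D expand[symmetric])
  finally show ?thesis .
qed

text \<open>Differentiating the pullback of \<open>f'\<close> along \<open>\<tau>\<close> produces, besides the pullback of the derivative of
\<open>f'\<close>, one term with a second derivative of \<open>\<tau>\<close> for each argument. Both naturality statements below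
consist in following these extra terms.\<close>

lemma pullback_derivative:
  fixes \<tau> :: "'b::real_inner \<Rightarrow> 'b" and e :: "nat \<Rightarrow> 'b"
  assumes fr: "euclidean_frame e m" and S: "open S" "open S'" and \<tau>: "smooth_on \<tau> S" "\<tau> ` S \<subseteq> S'"
    and f': "form_on S' n f'"
    and pull: "\<And>z ws. z \<in> S \<Longrightarrow> length ws = n \<Longrightarrow> f z ws = f' (\<tau> z) (map (frechet_derivative \<tau> (at z)) ws)"
    and y: "y \<in> S" and len: "length ws = n"
  shows "frechet_derivative (\<lambda>z. f z ws) (at y) u
    = frechet_derivative (\<lambda>z. f' z (map (frechet_derivative \<tau> (at y)) ws)) (at (\<tau> y)) (frechet_derivative \<tau> (at y) u)
    + (\<Sum>k<n. f' (\<tau> y) ((map (frechet_derivative \<tau> (at y)) ws)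
        [k := frechet_derivative (\<lambda>z. frechet_derivative \<tau> (at z) (ws ! k)) (at y) u]))"
proof -
  let ?D = "\<lambda>z. frechet_derivative \<tau> (at z)"
  define vs where "vs = map (\<lambda>w z. ?D z w) ws"
  define dvs where "dvs = map (\<lambda>w. frechet_derivative (\<lambda>z. ?D z w) (at y)) ws"
  have map_vs: "map (\<lambda>v. v z) vs = map (?D z) ws" for z by (simp add: vs_def)
  have "((\<lambda>z. f' (\<tau> z) (map (\<lambda>v. v z) vs)) has_derivative
     (\<lambda>h. frechet_derivative (\<lambda>z. f' z (map (\<lambda>v. v y) vs)) (at (\<tau> y)) (?D y h)
        + (\<Sum>k<n. f' (\<tau> y) ((map (\<lambda>v. v y) vs)[k := (dvs ! k) h])))) (at y)"
  proof (rule has_derivative_multilinear[OF fr _ S(2)])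
    show "(\<tau> has_derivative ?D y) (at y)"
      using smooth_on_differentiable[OF \<tau>(1) y] by (simp add: frechet_derivative_works)
    show "((vs ! k) has_derivative (dvs ! k)) (at y)" if "k < n" for k
      using smooth_on_differentiable[OF smooth_on_derivative[OF \<tau>(1)] y] that len
      by (simp add: vs_def dvs_def frechet_derivative_works)
    show "(\<lambda>z. f' z ws) differentiable at (\<tau> y)" for ws
      using form_on_differentiable[OF f'] \<tau>(2) y by blast
  qed (use \<tau>(2) y len f' in \<open>auto simp: vs_def dvs_def form_on_def\<close>)
  then have "((\<lambda>z. f z ws) has_derivative
     (\<lambda>h. frechet_derivative (\<lambda>z. f' z (map (\<lambda>v. v y) vs)) (at (\<tau> y)) (?D y h)
        + (\<Sum>k<n. f' (\<tau> y) ((map (\<lambda>v. v y) vs)[k := (dvs ! k) h])))) (at y)"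
    by (rule has_derivative_transform_within_open[OF _ S(1) y]) (simp add: pull len map_vs)
  then have "frechet_derivative (\<lambda>z. f z ws) (at y) u
     = frechet_derivative (\<lambda>z. f' z (map (\<lambda>v. v y) vs)) (at (\<tau> y)) (?D y u)
        + (\<Sum>k<n. f' (\<tau> y) ((map (\<lambda>v. v y) vs)[k := (dvs ! k) u]))"
    by (simp add: frechet_derivative_at[symmetric])
  also have "(\<Sum>k<n. f' (\<tau> y) ((map (\<lambda>v. v y) vs)[k := (dvs ! k) u]))
      = (\<Sum>k<n. f' (\<tau> y) ((map (?D y) ws)[k := frechet_derivative (\<lambda>z. ?D z (ws ! k)) (at y) u]))"
    by (intro sum.cong refl) (simp add: map_vs dvs_def len)
  finally show ?thesis by (simp add: map_vs)
qed

text \<open>The map on the arguments is the derivative of the tangent map \<open>(z, u) \<mapsto> (\<tau> z, D\<tau>(z) u)\<close>. Its second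
component contains the derivative of \<open>z \<mapsto> D\<tau>(z) u\<close> in direction \<open>a\<^sub>k\<close>; the extra terms of the
pullback are the derivatives of \<open>z \<mapsto> D\<tau>(z) a\<^sub>k\<close> in direction \<open>u\<close>, and these agree.\<close>

lemma intrinsic_lift_natural:
  fixes \<tau> :: "'b::real_inner \<Rightarrow> 'b" and e :: "nat \<Rightarrow> 'b"
  assumes fr: "euclidean_frame e m" and S: "open S" "open S'" and \<tau>: "smooth_on \<tau> S" "\<tau> ` S \<subseteq> S'"
    and f': "form_on S' n f'"
    and pull: "\<And>z ws. z \<in> S \<Longrightarrow> length ws = n \<Longrightarrow> f z ws = f' (\<tau> z) (map (frechet_derivative \<tau> (at z)) ws)"
    and y: "y \<in> S" and len: "length ws = n"
  shows "intrinsic_lift f (y, u) ws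
    = intrinsic_lift f' (\<tau> y, frechet_derivative \<tau> (at y) u)
       (map (\<lambda>(a, b). (frechet_derivative \<tau> (at y) a,
           frechet_derivative (\<lambda>z. frechet_derivative \<tau> (at z) u) (at y) a + frechet_derivative \<tau> (at y) b)) ws)"
proof -
  let ?D = "frechet_derivative \<tau> (at y)"
  let ?H = "\<lambda>u. frechet_derivative (\<lambda>z. frechet_derivative \<tau> (at z) u) (at y)"
  let ?as = "map fst ws"
  have sym: "?H a u = ?H u a" for a
    by (rule second_derivative_symmetric[OF S(1) smooth_on_C2[OF \<tau>(1)] y])
  have ml: "multilinear n (f' (\<tau> y))" using f' \<tau>(2) y by (auto simp: form_on_def)
  have "(\<Sum>k<n. f y (?as[k := snd (ws ! k)]))
      = (\<Sum>k<n. f' (\<tau> y) ((map ?D ?as)[k := ?D (snd (ws ! k))]))"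
    using y len by (simp add: pull map_update)
  moreover have "frechet_derivative (\<lambda>z. f z ?as) (at y) u
      = frechet_derivative (\<lambda>z. f' z (map ?D ?as)) (at (\<tau> y)) (?D u)
        + (\<Sum>k<n. f' (\<tau> y) ((map ?D ?as)[k := ?H u (fst (ws ! k))]))"
    using pullback_derivative[OF fr S \<tau> f' pull y, of ?as u] len by (simp add: sym)
  moreover have "f' (\<tau> y) ((map ?D ?as)[k := ?H u (fst (ws ! k)) + ?D (snd (ws ! k))])
      = f' (\<tau> y) ((map ?D ?as)[k := ?H u (fst (ws ! k))]) + f' (\<tau> y) ((map ?D ?as)[k := ?D (snd (ws ! k))])"
    if "k < n" for k
    using linear_add[OF linear_slot[OF ml, of "map ?D ?as" k]] that len by simp
  ultimately show ?thesis
    using len by (simp add: intrinsic_lift_def o_def case_prod_unfold sum.distrib)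
qed

lemma nth_omit: "k < length ws - 1 \<Longrightarrow> omit i ws ! k = (if k < i then ws ! k else ws ! Suc k)"
  by (auto simp: omit_def nth_append min_def)

lemma omit_omit:
  "i \<le> k \<Longrightarrow> Suc k < length ws \<Longrightarrow> omit k (omit i ws) = omit i (omit (Suc k) ws)"
  by (rule nth_equalityI) (auto simp: nth_omit)

text \<open>The cancellation behind \<open>d d = 0\<close>: omitting two entries in either order gives the same list with
opposite signs, and the indices \<open>(i, k)\<close> with \<open>i \<le> k\<close> are paired with \<open>(Suc k, i)\<close>.\<close>

lemma alternating_double_sum:
  fixes G :: "nat \<Rightarrow> nat \<Rightarrow> real"
  assumes "\<And>i k. i \<le> k \<Longrightarrow> k < n \<Longrightarrow> G i k = G (Suc k) i"
  shows "(\<Sum>i<Suc n. \<Sum>k<n. (- 1) ^ (i + k) * G i k) = 0"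
proof -
  let ?g = "\<lambda>(i, k). (- 1) ^ (i + k) * G i k"
  let ?U = "{(i, k). i \<le> k \<and> k < n}" and ?L = "{(i, k). k < i \<and> i < Suc n}"
  have split: "{..<Suc n} \<times> {..<n} = ?U \<union> ?L" "?U \<inter> ?L = {}" by auto
  have fin: "finite ?U" "finite ?L"
    by (rule finite_subset[of _ "{..<Suc n} \<times> {..<n}"]; auto)+
  have "sum (\<lambda>p. - ?g p) ?U = sum ?g ?L"
    by (rule sum.reindex_bij_witness[of _ "\<lambda>(i, k). (k, i - 1)" "\<lambda>(i, k). (Suc k, i)"])
       (auto simp: assms add.commute)
  then have "sum ?g ({..<Suc n} \<times> {..<n}) = 0"
    unfolding split(1) by (subst sum.union_disjoint[OF fin split(2)]) (simp add: sum_negf)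
  then show ?thesis by (simp add: sum.cartesian_product)
qed

text \<open>The exterior derivative commutes with pullbacks: the extra terms with second derivatives of \<open>\<tau>\<close> are
symmetric in the two directions involved and cancel in the alternating sum.\<close>

lemma local_ext_deriv_natural:
  fixes \<tau> :: "'b::real_inner \<Rightarrow> 'b" and e :: "nat \<Rightarrow> 'b"
  assumes fr: "euclidean_frame e m" and S: "open S" "open S'" and \<tau>: "smooth_on \<tau> S" "\<tau> ` S \<subseteq> S'"
    and f': "form_on S' n f'"
    and pull: "\<And>z ws. z \<in> S \<Longrightarrow> length ws = n \<Longrightarrow> f z ws = f' (\<tau> z) (map (frechet_derivative \<tau> (at z)) ws)"
    and y: "y \<in> S" and len: "length ws = Suc n"
  shows "local_ext_deriv f y ws = local_ext_deriv f' (\<tau> y) (map (frechet_derivative \<tau> (at y)) ws)"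
proof -
  let ?D = "frechet_derivative \<tau> (at y)"
  let ?H = "\<lambda>u. frechet_derivative (\<lambda>z. frechet_derivative \<tau> (at z) u) (at y)"
  let ?W = "map ?D ws"
  have ml: "multilinear n (f' (\<tau> y))" and al: "alternating n (f' (\<tau> y))"
    using f' \<tau>(2) y by (auto simp: form_on_def)
  \<comment> \<open>The second derivative is moved to the front, so that only its symmetry in both directions is left to use.\<close>
  define G where "G = (\<lambda>i k. f' (\<tau> y) (?H (omit i ws ! k) (ws ! i) # omit k (omit i ?W)))"
  have "frechet_derivative (\<lambda>z. f z (omit i ws)) (at y) (ws ! i)
      = frechet_derivative (\<lambda>z. f' z (omit i ?W)) (at (\<tau> y)) (?D (ws ! i)) + (\<Sum>k<n. (- 1) ^ k * G i k)"
    if i: "i < Suc n" for i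
  proof -
    have len': "length (omit i ws) = n" "length (omit i ?W) = n" using i len by auto
    have "(\<Sum>k<n. f' (\<tau> y) ((omit i ?W)[k := ?H (omit i ws ! k) (ws ! i)])) = (\<Sum>k<n. (- 1) ^ k * G i k)"
      unfolding G_def by (intro sum.cong refl alternating_update[OF ml al len'(2)]) auto
    then show ?thesis
      using pullback_derivative[OF fr S \<tau> f' pull y len'(1), of "ws ! i"] by (simp add: map_omit)
  qed
  then have "local_ext_deriv f y ws = local_ext_deriv f' (\<tau> y) ?W
      + (\<Sum>i<Suc n. \<Sum>k<n. (- 1) ^ (i + k) * G i k)"
    by (simp add: local_ext_deriv_def omit_def[symmetric] len distrib_left sum.distrib
        sum_distrib_left power_add mult.assoc del: sum.lessThan_Suc)
  moreover have "G i k = G (Suc k) i" if "i \<le> k" "k < n" for i k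
    unfolding G_def using that len
    by (simp add: nth_omit omit_omit second_derivative_symmetric[OF S(1) smooth_on_C2[OF \<tau>(1)] y, of "ws ! i"])
  ultimately show ?thesis using alternating_double_sum[of n G] by simp
qed

text \<open>Here \<open>g\<close> is the contraction of the lift of \<open>f\<close> with the tautological field. It is linear in \<open>u\<close>, so
its derivative in direction \<open>(a, b)\<close> is a derivative of \<open>f\<close> in direction \<open>a\<close> plus a term with \<open>u\<close>
replaced by \<open>b\<close>. In the alternating sum, the latter terms form the second part of the lift, and
closedness of \<open>f\<close>, evaluated on \<open>u\<close> followed by all \<open>a\<^sub>k\<close>, turns the former into the first part.\<close>

lemma lift_eq_ext_deriv_of_contraction:
  fixes e :: "nat \<Rightarrow> 'e::real_inner" and f :: "'e \<Rightarrow> 'e list \<Rightarrow> real"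
  assumes fr: "euclidean_frame e m" and S: "open S" and f: "form_on S (Suc n) f" and y: "y \<in> S"
    and len: "length ws = Suc n"
    and closed: "local_ext_deriv f y (u # map fst ws) = 0"
    and g: "\<And>z vs. z \<in> S \<times> UNIV \<Longrightarrow> length vs = n \<Longrightarrow> g z vs = f (fst z) (snd z # map fst vs)"
  shows "local_ext_deriv g (y, u) ws = intrinsic_lift f (y, u) ws"
proof -
  let ?as = "map fst ws"
  let ?D = "\<lambda>i. frechet_derivative (\<lambda>z. f z (u # omit i ?as)) (at y)"
  have ml: "multilinear (Suc n) (f y)" and al: "alternating (Suc n) (f y)"
    using f y by (auto simp: form_on_def)
  have main: "frechet_derivative (\<lambda>z. g z (omit i ws)) (at (y, u)) h = ?D i (fst h) + f y (snd h # omit i ?as)"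
    if i: "i < Suc n" for i h
  proof -
    \<comment> \<open>Only the first argument varies, so the product rule is applied to a form of degree 1.\<close>
    let ?F = "\<lambda>z vs. f z (hd vs # omit i ?as)"
    have "((\<lambda>x. ?F (fst x) (map (\<lambda>v. v x) [snd])) has_derivative
     (\<lambda>h. frechet_derivative (\<lambda>z. ?F z (map (\<lambda>v. v (y, u)) [snd])) (at (fst (y, u))) (fst h)
        + (\<Sum>k<1. ?F (fst (y, u)) ((map (\<lambda>v. v (y, u)) [snd])[k := ([snd] ! k) h])))) (at (y, u))"
    proof (rule has_derivative_multilinear[OF fr _ S])
      show "(fst has_derivative fst) (at (y, u))" by (intro derivative_intros)
      show "fst (y, u) \<in> S" using y by simp
      show "(([snd] ! k) has_derivative ([snd] ! k)) (at (y, u))" if "k < 1" for k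
        using that by (auto intro!: derivative_intros)
      show "(\<lambda>z. ?F z ws) differentiable at (fst (y, u))" for ws
        using form_on_differentiable[OF f y] by simp
      show "multilinear 1 (?F z)" if "z \<in> S" for z
        unfolding multilinear_def
      proof (intro allI impI)
        fix vs :: "'e list" and j :: nat and v w a b
        assume "length vs = 1" "j < 1"
        moreover have lin: "linear (\<lambda>v. f z (v # omit i ?as))"
          using f that i len by (intro linear_Cons[of n]) (auto simp: form_on_def)
        ultimately show "?F z (vs[j := a *\<^sub>R v + b *\<^sub>R w]) = a * ?F z (vs[j := v]) + b * ?F z (vs[j := w])"
          by (cases vs) (auto simp: linear_add[OF lin] linear_cmul[OF lin])
      qed
    qed simp_all
    then have "((\<lambda>x. f (fst x) (snd x # omit i ?as)) has_derivative
        (\<lambda>h. ?D i (fst h) + f y (snd h # omit i ?as))) (at (y, u))" by simp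
    then have "((\<lambda>z. g z (omit i ws)) has_derivative (\<lambda>h. ?D i (fst h) + f y (snd h # omit i ?as))) (at (y, u))"
      by (rule has_derivative_transform_within_open[OF _ open_Times[OF S open_UNIV]])
         (use y len i in \<open>auto simp: g map_omit\<close>)
    then show ?thesis by (simp add: frechet_derivative_at[symmetric])
  qed
  have "local_ext_deriv g (y, u) ws = (\<Sum>i<Suc n. (- 1) ^ i * (?D i (?as ! i) + f y (snd (ws ! i) # omit i ?as)))"
    unfolding local_ext_deriv_def omit_def[symmetric] len
    by (intro sum.cong refl) (simp add: main len del: sum.lessThan_Suc)
  also have "\<dots> = (\<Sum>i<Suc n. (- 1) ^ i * ?D i (?as ! i)) + (\<Sum>i<Suc n. f y (?as[i := snd (ws ! i)]))"
    using alternating_update[OF ml al, of ?as] len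
    by (simp add: distrib_left sum.distrib del: sum.lessThan_Suc)
  also have "(\<Sum>i<Suc n. (- 1) ^ i * ?D i (?as ! i)) = frechet_derivative (\<lambda>z. f z ?as) (at y) u"
  proof -
    have "0 = (\<Sum>i<Suc (Suc n). (- 1) ^ i *
        frechet_derivative (\<lambda>z. f z (omit i (u # ?as))) (at y) ((u # ?as) ! i))"
      using closed len unfolding local_ext_deriv_def omit_def[symmetric] by simp
    also have "\<dots> = frechet_derivative (\<lambda>z. f z ?as) (at y) u - (\<Sum>i<Suc n. (- 1) ^ i * ?D i (?as ! i))"
      unfolding sum.lessThan_Suc_shift[of _ "Suc n"] by (simp add: sum_negf del: sum.lessThan_Suc)
    finally show ?thesis by simp
  qed
  finally show ?thesis by (simp add: intrinsic_lift_def len del: sum.lessThan_Suc)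
qed

text \<open>A vertical vector \<open>(0, w)\<close> contributes only through the slot where its second component is inserted;
all other terms contain the argument \<open>0\<close>.\<close>

lemma intrinsic_lift_contraction:
  assumes S: "open S" and f: "form_on S (Suc n) f" and y: "y \<in> S" and len: "length ws = n"
  shows "intrinsic_lift f (y, u) ((0, w) # ws) = f y (w # map fst ws)"
proof -
  have zero: "f z (0 # as) = 0" if "z \<in> S" "length as = n" for z as
    using linear_0[OF linear_Cons[of n "f z" as]] f that by (auto simp: form_on_def)
  have "((\<lambda>z. f z (0 # map fst ws)) has_derivative (\<lambda>h. 0)) (at y)"
    by (rule has_derivative_transform_within_open[OF has_derivative_const S y, of 0])
       (simp add: zero len)
  then show ?thesis
    unfolding intrinsic_lift_def
    by (simp add: frechet_derivative_at[symmetric] sum.lessThan_Suc_shift zero y len del: sum.lessThan_Suc)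
qed

lemma intrinsic_lift_homogeneous:
  assumes f: "form_on S n f" and y: "y \<in> S" and len: "length ws = n"
  shows "intrinsic_lift f (y, c *\<^sub>R u) (map (\<lambda>(a, b). (a, c *\<^sub>R b)) ws) = c * intrinsic_lift f (y, u) ws"
proof -
  have ml: "multilinear n (f y)" using f y by (auto simp: form_on_def)
  have "f y ((map fst ws)[k := c *\<^sub>R snd (ws ! k)]) = c * f y ((map fst ws)[k := snd (ws ! k)])"
    if "k < n" for k
    using linear_cmul[OF linear_slot[OF ml, of "map fst ws" k]] that len by simp
  moreover have "frechet_derivative (\<lambda>z. f z as) (at y) (c *\<^sub>R u) = c * frechet_derivative (\<lambda>z. f z as) (at y) u" for as
    using linear_frechet_derivative[OF form_on_differentiable[OF f y]] by (simp add: linear_cmul)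
  ultimately show ?thesis
    using len by (simp add: intrinsic_lift_def o_def case_prod_unfold distrib_left sum_distrib_left)
qed

lemma smooth_on_intrinsic_lift:
  fixes f :: "'e::real_inner \<Rightarrow> 'e list \<Rightarrow> real" and e :: "nat \<Rightarrow> 'e"
  assumes fr: "euclidean_frame e m" and S: "open S" and f: "form_on S n f"
  shows "smooth_on (\<lambda>z. intrinsic_lift f z ws) (S \<times> UNIV)"
proof -
  let ?D = "\<lambda>y. frechet_derivative (\<lambda>z. f z (map fst ws)) (at y)"
  have op: "open (S \<times> (UNIV :: 'e set))" using S by (rule open_Times) simp
  have sm: "smooth_on (\<lambda>y. f y vs) S" for vs using f by (simp add: form_on_def)
  have "smooth_on (\<lambda>z. (\<Sum>j<m. (snd z \<bullet> e j) * ?D (fst z) (e j))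
      + (\<Sum>k<length ws. f (fst z) ((map fst ws)[k := snd (ws ! k)]))) (S \<times> UNIV)"
    by (intro smooth_on_add smooth_on_sum smooth_on_mult op smooth_on_compose_fst S sm
        smooth_on_compose_fst[of S "\<lambda>y. ?D y (e _)"] smooth_on_derivative
        smooth_on_bounded_linear bounded_linear_inner_left_comp bounded_linear_snd)
  then show ?thesis
  proof (rule smooth_on_cong[OF op])
    fix z :: "'e \<times> 'e" assume "z \<in> S \<times> UNIV"
    then have "linear (?D (fst z))"
      by (intro linear_frechet_derivative form_on_differentiable[OF f]) auto
    from linear_frame_expansion[OF fr this, of "snd z"]
    show "(\<Sum>j<m. (snd z \<bullet> e j) * ?D (fst z) (e j))
        + (\<Sum>k<length ws. f (fst z) ((map fst ws)[k := snd (ws ! k)])) = intrinsic_lift f z ws"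
      by (simp add: intrinsic_lift_def case_prod_unfold)
  qed
qed

section \<open>The flow of the tautological field\<close>

text \<open>Along an integral curve \<open>(y, u)\<close> of \<open>(0, u)\<close>, both \<open>y\<close> and \<open>e\<^sup>-\<^sup>t u\<close> have derivative \<open>0\<close>. The
Lie derivative is defined with an arbitrary flow, so all flows have to be determined.\<close>

lemma local_flow_of_fibre_scaling:
  assumes flow: "local_flow F (W \<times> UNIV) \<epsilon> V \<Psi>"
    and F: "\<And>z. z \<in> W \<times> UNIV \<Longrightarrow> F z = (0, snd z)"
    and z: "z \<in> V" and t: "t \<in> {- \<epsilon><..<\<epsilon>}"
  shows "\<Psi> (t, z) = (fst z, exp t *\<^sub>R snd z)"
proof -
  let ?I = "{- \<epsilon><..<\<epsilon>}"
  define g where "g = (\<lambda>s. \<Psi> (s, z))"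
  have g0: "g 0 = z" using flow z by (simp add: local_flow_def g_def)
  have 0: "0 \<in> ?I" using flow by (simp add: local_flow_def)
  have dg: "(g has_vector_derivative (0, snd (g s))) (at s)" if s: "s \<in> ?I" for s
  proof -
    have "(g has_vector_derivative F (g s)) (at s)" "g s \<in> W \<times> UNIV"
      using flow z s unfolding local_flow_def g_def by auto
    then show ?thesis using F by simp
  qed
  have "((\<lambda>s. fst (g s)) has_vector_derivative 0) (at s within ?I)" if "s \<in> ?I" for s
    using bounded_linear.has_vector_derivative[OF bounded_linear_fst dg[OF that]]
    by (auto intro: has_vector_derivative_at_within)
  then obtain c1 where c1: "\<And>s. s \<in> ?I \<Longrightarrow> fst (g s) = c1"
    using has_vector_derivative_zero_constant[of ?I "\<lambda>s. fst (g s)"] by auto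
  have "((\<lambda>s. exp (- s) *\<^sub>R snd (g s)) has_vector_derivative 0) (at s within ?I)" if "s \<in> ?I" for s
  proof -
    have "((\<lambda>s. snd (g s)) has_vector_derivative snd (g s)) (at s)"
      using bounded_linear.has_vector_derivative[OF bounded_linear_snd dg[OF that]] by simp
    moreover have "((\<lambda>s. exp (- s)) has_field_derivative - exp (- s)) (at s)"
      by (auto intro!: derivative_eq_intros)
    ultimately have "((\<lambda>s. exp (- s) *\<^sub>R snd (g s)) has_vector_derivative
        exp (- s) *\<^sub>R snd (g s) + (- exp (- s)) *\<^sub>R snd (g s)) (at s)"
      by (intro has_vector_derivative_scaleR)
    then show ?thesis by (auto intro: has_vector_derivative_at_within)
  qed
  then obtain c2 where c2: "\<And>s. s \<in> ?I \<Longrightarrow> exp (- s) *\<^sub>R snd (g s) = c2"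
    using has_vector_derivative_zero_constant[of ?I "\<lambda>s. exp (- s) *\<^sub>R snd (g s)"] by auto
  have "exp (- t) *\<^sub>R snd (g t) = snd z" using c2[OF t] c2[OF 0] g0 by simp
  then have "exp t *\<^sub>R snd z = snd (g t)" by (simp add: exp_minus flip: \<open>_ = snd z\<close>)
  moreover have "fst (g t) = fst z" using c1[OF t] c1[OF 0] g0 by simp
  ultimately show ?thesis by (simp add: g_def prod_eq_iff)
qed

lemma local_flow_fibre_scaling:
  fixes F :: "'b::real_inner \<times> 'b \<Rightarrow> 'b \<times> 'b"
  assumes W: "open W" and F: "\<And>z. z \<in> W \<times> UNIV \<Longrightarrow> F z = (0, snd z)"
  shows "local_flow F (W \<times> UNIV) 1 (W \<times> UNIV) (\<lambda>(t, z). (fst z, exp t *\<^sub>R snd z))"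
proof -
  let ?T = "{- 1<..<1} \<times> (W \<times> UNIV) :: (real \<times> 'b \<times> 'b) set"
  have op: "open ?T" using W by (intro open_Times) auto
  have "smooth_on (\<lambda>p::real \<times> 'b \<times> 'b. (fst (snd p), 0) + (exp (fst p) * 1) *\<^sub>R (0, snd (snd p))) ?T"
  proof (intro smooth_on_add smooth_on_scaleR op)
    show "smooth_on (\<lambda>p::real \<times> 'b \<times> 'b. exp (fst p) * 1) ?T"
      unfolding smooth_on_def using C_k_on_exp_fst[OF op] by blast
  qed (intro smooth_on_bounded_linear op bounded_linear_Pair bounded_linear_zero
        bounded_linear_compose[OF bounded_linear_fst bounded_linear_snd]
        bounded_linear_compose[OF bounded_linear_snd bounded_linear_snd])+
  then have "smooth_on (\<lambda>(t, z). (fst z, exp t *\<^sub>R snd z)) ?T"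
    by (rule smooth_on_cong[OF op]) auto
  moreover have "((\<lambda>s. (fst z, exp s *\<^sub>R snd z)) has_vector_derivative F (fst z, exp t *\<^sub>R snd z)) (at t)"
    if "z \<in> W \<times> UNIV" for z t
  proof -
    have "F (fst z, exp t *\<^sub>R snd z) = (0, exp t *\<^sub>R snd z)" using that by (subst F) auto
    moreover have "((\<lambda>s. exp s *\<^sub>R snd z) has_vector_derivative exp t *\<^sub>R snd z) (at t)"
      by (auto intro!: derivative_eq_intros)
    ultimately show ?thesis by (auto intro!: has_vector_derivative_Pair has_vector_derivative_const)
  qed
  ultimately show ?thesis using W by (auto simp: local_flow_def intro!: open_Times)
qed

text \<open>Pulling back along the flow replaces \<open>(y, u)\<close> and the arguments by their images under scaling of the
second component by \<open>e\<^sup>t\<close>, hence multiplies the form by \<open>e\<^sup>t\<close>.\<close>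

lemma local_lie_deriv_of_homogeneous:
  fixes F :: "'b::real_inner \<times> 'b \<Rightarrow> 'b \<times> 'b"
  assumes W: "open W" and F: "\<And>z. z \<in> W \<times> UNIV \<Longrightarrow> F z = (0, snd z)"
    and z: "z \<in> W \<times> UNIV"
    and hom: "\<And>c. f (fst z, c *\<^sub>R snd z) (map (\<lambda>(a, b). (a, c *\<^sub>R b)) ws) = c * f z ws"
  shows "local_lie_deriv F (W \<times> UNIV) f z ws = f z ws"
proof -
  define \<Psi> where "\<Psi> = (SOME \<Psi>. \<exists>\<epsilon> V. z \<in> V \<and> local_flow F (W \<times> UNIV) \<epsilon> V \<Psi>)"
  have "\<exists>\<Psi> \<epsilon> V. z \<in> V \<and> local_flow F (W \<times> UNIV) \<epsilon> V \<Psi>"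
    by (intro exI conjI, rule z, rule local_flow_fibre_scaling[OF W F])
  then have "\<exists>\<epsilon> V. z \<in> V \<and> local_flow F (W \<times> UNIV) \<epsilon> V \<Psi>"
    unfolding \<Psi>_def by (rule someI_ex)
  then obtain \<epsilon> V where V: "z \<in> V" and flow: "local_flow F (W \<times> UNIV) \<epsilon> V \<Psi>" by blast
  have \<epsilon>: "\<epsilon> > 0" and opV: "open V" using flow by (auto simp: local_flow_def)
  have \<Psi>: "\<Psi> (t, z') = (fst z', exp t *\<^sub>R snd z')" if "t \<in> {- \<epsilon><..<\<epsilon>}" "z' \<in> V" for t z'
    by (rule local_flow_of_fibre_scaling[OF flow F that(2,1)])
  let ?h = "\<lambda>t. f (\<Psi> (t, z)) (map (frechet_derivative (\<lambda>z. \<Psi> (t, z)) (at z)) ws)"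
  have h: "exp t * f z ws = ?h t" if t: "t \<in> {- \<epsilon><..<\<epsilon>}" for t
  proof -
    have "((\<lambda>z'. (fst z', exp t *\<^sub>R snd z')) has_derivative (\<lambda>h. (fst h, exp t *\<^sub>R snd h))) (at z)"
      by (auto intro!: derivative_eq_intros)
    then have "((\<lambda>z'. \<Psi> (t, z')) has_derivative (\<lambda>h. (fst h, exp t *\<^sub>R snd h))) (at z)"
      by (rule has_derivative_transform_within_open[OF _ opV V]) (simp add: \<Psi>[OF t])
    then have "frechet_derivative (\<lambda>z. \<Psi> (t, z)) (at z) = (\<lambda>(a, b). (a, exp t *\<^sub>R b))"
      by (simp add: frechet_derivative_at[symmetric] case_prod_unfold)
    then show ?thesis by (simp add: \<Psi>[OF t V] hom)
  qed
  have "((\<lambda>t. exp t * f z ws) has_field_derivative f z ws) (at 0)"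
    by (auto intro!: derivative_eq_intros)
  then have "(?h has_field_derivative f z ws) (at 0)"
    by (rule has_field_derivative_transform_within_open[of _ _ _ "{- \<epsilon><..<\<epsilon>}"]) (use \<epsilon> h in auto)
  then show ?thesis by (simp add: local_lie_deriv_def Let_def \<Psi>_def[symmetric] DERIV_imp_deriv)
qed

section \<open>Tangent vectors and forms in charts\<close>

text \<open>Differentiable transition maps suffice for tangent vectors to have well-defined components in every
chart. The assumptions are weak enough to be verified for the tangent bundle directly from the
formula for its transition maps.\<close>

locale differentiable_atlas =
  fixes A :: "('a, 'e::real_inner) chart set"
  assumes chart_inj: "c \<in> A \<Longrightarrow> inj_on (snd c) (fst c)"
    and open_overlap: "c \<in> A \<Longrightarrow> c' \<in> A \<Longrightarrow> open (snd c ` (fst c \<inter> fst c'))"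
    and differentiable_transition:
      "c \<in> A \<Longrightarrow> c' \<in> A \<Longrightarrow> x \<in> fst c \<Longrightarrow> x \<in> fst c' \<Longrightarrow> transition c c' differentiable (at (snd c x))"
begin

lemma open_chart_image: "c \<in> A \<Longrightarrow> open (snd c ` fst c)"
  using open_overlap[of c c] by simp

lemma chart_inv_chart: "c \<in> A \<Longrightarrow> x \<in> fst c \<Longrightarrow> chart_inv c (snd c x) = x"
  unfolding chart_inv_def by (rule inv_into_f_f[OF chart_inj])

lemma transition_chart: "c \<in> A \<Longrightarrow> x \<in> fst c \<Longrightarrow> transition c c' (snd c x) = snd c' x"
  by (simp add: transition_def chart_inv_chart)

abbreviation jacobian where
  "jacobian c c' x \<equiv> frechet_derivative (transition c c') (at (snd c x))"

lemma has_derivative_transition: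
  "c \<in> A \<Longrightarrow> c' \<in> A \<Longrightarrow> x \<in> fst c \<Longrightarrow> x \<in> fst c' \<Longrightarrow>
    (transition c c' has_derivative jacobian c c' x) (at (snd c x))"
  using differentiable_transition frechet_derivative_works by blast

lemma linear_jacobian:
  "c \<in> A \<Longrightarrow> c' \<in> A \<Longrightarrow> x \<in> fst c \<Longrightarrow> x \<in> fst c' \<Longrightarrow> linear (jacobian c c' x)"
  using differentiable_transition linear_frechet_derivative by blast

lemma jacobian_self:
  assumes "c \<in> A" "x \<in> fst c"
  shows "jacobian c c x w = w"
proof -
  have "(transition c c has_derivative (\<lambda>h. h)) (at (snd c x))"
    by (rule has_derivative_transform_within_open[OF has_derivative_ident open_chart_image[OF assms(1)]])
       (use assms in \<open>auto simp: transition_chart\<close>)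
  then show ?thesis by (simp add: frechet_derivative_at[symmetric])
qed

lemma jacobian_cocycle:
  assumes c: "c \<in> A" "c' \<in> A" "c'' \<in> A" and x: "x \<in> fst c" "x \<in> fst c'" "x \<in> fst c''"
  shows "jacobian c c'' x w = jacobian c' c'' x (jacobian c c' x w)"
proof -
  have "((transition c' c'' \<circ> transition c c') has_derivative (jacobian c' c'' x \<circ> jacobian c c' x)) (at (snd c x))"
    using diff_chain_at[OF has_derivative_transition[OF c(1,2) x(1,2)], of "transition c' c''"]
      has_derivative_transition[OF c(2,3) x(2,3)] by (simp add: transition_chart c x)
  then have "(transition c c'' has_derivative (jacobian c' c'' x \<circ> jacobian c c' x)) (at (snd c x))"
    by (rule has_derivative_transform_within_open[OF _ open_overlap[OF c(1,2)]])
       (use c x in \<open>auto simp: transition_chart\<close>)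
  then show ?thesis by (simp add: frechet_derivative_at[symmetric])
qed

lemma tvec_of_in_tangent_space:
  assumes "c \<in> A" "x \<in> fst c"
  shows "tvec_of A c x w \<in> tangent_space A x"
  unfolding tangent_space_def
proof (intro CollectI conjI ballI allI impI)
  fix c' c'' assume "c' \<in> A" "c'' \<in> A" "x \<in> fst c' \<and> x \<in> fst c''"
  then show "tvec_of A c x w c'' = jacobian c' c'' x (tvec_of A c x w c')"
    using jacobian_cocycle[OF assms(1) \<open>c' \<in> A\<close> \<open>c'' \<in> A\<close> assms(2), of w] by (simp add: tvec_of_def)
qed (auto simp: tvec_of_def)

lemma tvec_of_component [simp]: "c \<in> A \<Longrightarrow> x \<in> fst c \<Longrightarrow> tvec_of A c x w c = w"
  by (simp add: tvec_of_def jacobian_self)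

lemma tangent_vector_component:
  "v \<in> tangent_space A x \<Longrightarrow> c \<in> A \<Longrightarrow> c' \<in> A \<Longrightarrow> x \<in> fst c \<Longrightarrow> x \<in> fst c' \<Longrightarrow>
    v c' = jacobian c c' x (v c)"
  unfolding tangent_space_def by blast

lemma tangent_vector_outside:
  "v \<in> tangent_space A x \<Longrightarrow> \<not> (c \<in> A \<and> x \<in> fst c) \<Longrightarrow> v c = 0"
  unfolding tangent_space_def by blast

lemma tvec_of_components:
  assumes "v \<in> tangent_space A x" "c \<in> A" "x \<in> fst c"
  shows "tvec_of A c x (v c) = v"
proof
  fix c' show "tvec_of A c x (v c) c' = v c'"
    using tangent_vector_component[OF assms(1,2) _ assms(3), of c'] tangent_vector_outside[OF assms(1), of c']
    by (auto simp: tvec_of_def)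
qed

lemma tvec_of_change_chart:
  assumes c: "c \<in> A" "c' \<in> A" and x: "x \<in> fst c" "x \<in> fst c'"
  shows "tvec_of A c x w = tvec_of A c' x (jacobian c c' x w)"
proof
  fix c'' show "tvec_of A c x w c'' = tvec_of A c' x (jacobian c c' x w) c''"
    using jacobian_cocycle[OF c _ x, of c'' w] by (auto simp: tvec_of_def)
qed

lemma tvec_of_combination:
  "c \<in> A \<Longrightarrow> x \<in> fst c \<Longrightarrow>
    tvec_of A c x (a *\<^sub>R u + b *\<^sub>R w) = (\<lambda>c'. a *\<^sub>R tvec_of A c x u c' + b *\<^sub>R tvec_of A c x w c')"
  by (auto simp: tvec_of_def linear_add[OF linear_jacobian] linear_cmul[OF linear_jacobian])

lemma tangent_space_combination:
  assumes u: "u \<in> tangent_space A x" and w: "w \<in> tangent_space A x"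
  shows "(\<lambda>c. a *\<^sub>R u c + b *\<^sub>R w c) \<in> tangent_space A x"
  unfolding tangent_space_def
proof (intro CollectI conjI ballI allI impI)
  fix c c' assume c: "c \<in> A" "c' \<in> A" and "x \<in> fst c \<and> x \<in> fst c'"
  then have x: "x \<in> fst c" "x \<in> fst c'" by auto
  show "a *\<^sub>R u c' + b *\<^sub>R w c' = jacobian c c' x (a *\<^sub>R u c + b *\<^sub>R w c)"
    unfolding tangent_vector_component[OF u c x] tangent_vector_component[OF w c x]
    by (simp add: linear_add[OF linear_jacobian[OF c x]] linear_cmul[OF linear_jacobian[OF c x]])
qed (simp add: tangent_vector_outside[OF u] tangent_vector_outside[OF w])

lemma chart_at_props:
  assumes "x \<in> carrier A"
  shows "chart_at A x \<in> A" "x \<in> fst (chart_at A x)"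
proof -
  have "\<exists>c. c \<in> A \<and> x \<in> fst c" using assms by (auto simp: carrier_def)
  then have "chart_at A x \<in> A \<and> x \<in> fst (chart_at A x)"
    unfolding chart_at_def by (rule someI_ex)
  then show "chart_at A x \<in> A" "x \<in> fst (chart_at A x)" by auto
qed

lemma in_carrier: "c \<in> A \<Longrightarrow> x \<in> fst c \<Longrightarrow> x \<in> carrier A"
  by (auto simp: carrier_def)

lemma local_form_chart:
  "c \<in> A \<Longrightarrow> x \<in> fst c \<Longrightarrow> local_form A c \<omega> (snd c x) ws = \<omega> x (map (tvec_of A c x) ws)"
  by (simp add: local_form_def chart_inv_chart)

lemma local_form_components:
  assumes "c \<in> A" "x \<in> fst c" "set vs \<subseteq> tangent_space A x"
  shows "local_form A c \<omega> (snd c x) (map (\<lambda>v. v c) vs) = \<omega> x vs"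
proof -
  have "map (tvec_of A c x \<circ> (\<lambda>v. v c)) vs = vs"
    by (rule map_idI) (use assms in \<open>auto simp: tvec_of_components\<close>)
  then show ?thesis using assms by (simp add: local_form_chart)
qed

lemma local_form_change_chart:
  assumes "c \<in> A" "c' \<in> A" "y \<in> snd c ` (fst c \<inter> fst c')"
  shows "local_form A c \<omega> y ws
    = local_form A c' \<omega> (transition c c' y) (map (frechet_derivative (transition c c') (at y)) ws)"
proof -
  obtain x where x: "y = snd c x" "x \<in> fst c" "x \<in> fst c'" using assms(3) by blast
  have "tvec_of A c x = tvec_of A c' x \<circ> jacobian c c' x"
    using tvec_of_change_chart[OF assms(1,2) x(2,3)] by auto
  then show ?thesis using assms(1,2) x by (simp add: local_form_chart transition_chart)
qed

lemma form_on_local_form: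
  assumes "\<omega> \<in> forms A p" and c: "c \<in> A"
  shows "form_on (snd c ` fst c) p (local_form A c \<omega>)"
  unfolding form_on_def
proof (intro conjI ballI allI)
  fix y assume "y \<in> snd c ` fst c"
  then obtain x where x: "x \<in> fst c" "y = snd c x" by blast
  have x': "x \<in> carrier A" using c x by (auto simp: carrier_def)
  have sub: "set (map (tvec_of A c x) ws) \<subseteq> tangent_space A x" for ws
    using tvec_of_in_tangent_space[OF c x(1)] by auto
  have lf: "local_form A c \<omega> y = (\<lambda>ws. \<omega> x (map (tvec_of A c x) ws))"
    using c x by (auto simp: local_form_chart)
  show "multilinear p (local_form A c \<omega> y)"
    unfolding multilinear_def lf
  proof (intro allI impI)
    fix ws :: "'e list" and i :: nat and u w a b assume "length ws = p" "i < p"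
    then show "\<omega> x (map (tvec_of A c x) (ws[i := a *\<^sub>R u + b *\<^sub>R w]))
        = a * \<omega> x (map (tvec_of A c x) (ws[i := u])) + b * \<omega> x (map (tvec_of A c x) (ws[i := w]))"
      using assms(1) x' sub[of ws] tvec_of_in_tangent_space[OF c x(1)]
      unfolding map_update tvec_of_combination[OF c x(1)] forms_def by simp
  qed
  show "alternating p (local_form A c \<omega> y)"
    unfolding alternating_def lf
  proof (intro allI impI)
    fix ws :: "'e list" and i j assume "length ws = p" "i < p" "j < p" "i \<noteq> j" "ws ! i = ws ! j"
    moreover then have "map (tvec_of A c x) ws ! i = map (tvec_of A c x) ws ! j" by simp
    ultimately show "\<omega> x (map (tvec_of A c x) ws) = 0"
      using assms(1) x' sub[of ws] unfolding forms_def by auto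
  qed
next
  show "smooth_on (\<lambda>y. local_form A c \<omega> y ws) (snd c ` fst c)" for ws
    using assms by (simp add: forms_def)
qed

lemma forms_vanish:
  assumes "\<omega> \<in> forms A p" "\<not> (x \<in> carrier A \<and> length vs = p \<and> set vs \<subseteq> tangent_space A x)"
  shows "\<omega> x vs = 0"
proof -
  have "\<forall>x vs. \<not> (x \<in> carrier A \<and> length vs = p \<and> set vs \<subseteq> tangent_space A x) \<longrightarrow> \<omega> x vs = 0"
    using assms(1) unfolding forms_def mem_Collect_eq by (rule conjunct1)
  then show ?thesis using assms(2) by blast
qed

text \<open>Multilinearity and alternation are pointwise, so they may be verified in any one chart around each
point.\<close>

lemma formsI:
  assumes vanish: "\<And>x vs. \<not> (x \<in> carrier A \<and> length vs = p \<and> set vs \<subseteq> tangent_space A x) \<Longrightarrow> \<omega> x vs = 0"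
    and loc: "\<And>x. x \<in> carrier A \<Longrightarrow> \<exists>c F. c \<in> A \<and> x \<in> fst c \<and> multilinear p F \<and> alternating p F \<and>
       (\<forall>vs. length vs = p \<longrightarrow> set vs \<subseteq> tangent_space A x \<longrightarrow> \<omega> x vs = F (map (\<lambda>v. v c) vs))"
    and smooth: "\<And>c ws. c \<in> A \<Longrightarrow> smooth_on (\<lambda>y. local_form A c \<omega> y ws) (snd c ` fst c)"
  shows "\<omega> \<in> forms A p"
  unfolding forms_def
proof (intro CollectI conjI allI ballI impI smooth)
  fix x vs assume "\<not> (x \<in> carrier A \<and> length vs = p \<and> set vs \<subseteq> tangent_space A x)"
  then show "\<omega> x vs = 0" by (rule vanish)
next
  fix x vs i u w a b
  assume x: "x \<in> carrier A" and vs: "length vs = p \<and> set vs \<subseteq> tangent_space A x" and i: "i < p"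
    and uw: "u \<in> tangent_space A x" "w \<in> tangent_space A x"
  obtain c F where F: "multilinear p F"
    "\<And>vs. length vs = p \<Longrightarrow> set vs \<subseteq> tangent_space A x \<Longrightarrow> \<omega> x vs = F (map (\<lambda>v. v c) vs)"
    using loc[OF x] by blast
  have sub: "set (vs[i := v]) \<subseteq> tangent_space A x" if "v \<in> tangent_space A x" for v
    using vs that set_update_subset_insert[of vs i v] by blast
  show "\<omega> x (vs[i := (\<lambda>c. a *\<^sub>R u c + b *\<^sub>R w c)]) = a * \<omega> x (vs[i := u]) + b * \<omega> x (vs[i := w])"
    using vs i uw sub tangent_space_combination[OF uw]
    by (simp add: F(2) map_update multilinearD[OF F(1)])
next
  fix x vs i j
  assume x: "x \<in> carrier A" and vs: "length vs = p \<and> set vs \<subseteq> tangent_space A x"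
    and ij: "i < p" "j < p" "i \<noteq> j \<and> vs ! i = vs ! j"
  obtain c F where F: "alternating p F"
    "\<And>vs. length vs = p \<Longrightarrow> set vs \<subseteq> tangent_space A x \<Longrightarrow> \<omega> x vs = F (map (\<lambda>v. v c) vs)"
    using loc[OF x] by blast
  show "\<omega> x vs = 0" using vs ij alternatingD[OF F(1), of "map (\<lambda>v. v c) vs" i j] by (simp add: F(2))
qed

lemma ext_deriv_diff:
  assumes "\<omega> \<in> forms A p" "\<eta> \<in> forms A p"
  shows "ext_deriv A (\<lambda>x vs. \<omega> x vs - \<eta> x vs) = (\<lambda>x vs. ext_deriv A \<omega> x vs - ext_deriv A \<eta> x vs)"
proof (intro ext)
  fix x vs
  show "ext_deriv A (\<lambda>x vs. \<omega> x vs - \<eta> x vs) x vs = ext_deriv A \<omega> x vs - ext_deriv A \<eta> x vs"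
  proof (cases "x \<in> carrier A \<and> set vs \<subseteq> tangent_space A x")
    case True
    define c where "c = chart_at A x"
    have c: "c \<in> A" "x \<in> fst c" using chart_at_props True by (auto simp: c_def)
    have d: "((\<lambda>z. local_form A c \<theta> z ws) has_derivative
        frechet_derivative (\<lambda>z. local_form A c \<theta> z ws) (at (snd c x))) (at (snd c x))"
      if "\<theta> \<in> forms A p" for \<theta> ws
      using form_on_derivative[OF form_on_local_form[OF that c(1)]] c by blast
    have "frechet_derivative (\<lambda>z. local_form A c \<omega> z ws - local_form A c \<eta> z ws) (at (snd c x))
      = (\<lambda>h. frechet_derivative (\<lambda>z. local_form A c \<omega> z ws) (at (snd c x)) h
        - frechet_derivative (\<lambda>z. local_form A c \<eta> z ws) (at (snd c x)) h)" for ws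
      by (intro frechet_derivative_at[symmetric] has_derivative_diff d assms)
    moreover have "local_form A c (\<lambda>x vs. \<omega> x vs - \<eta> x vs) = (\<lambda>z ws. local_form A c \<omega> z ws - local_form A c \<eta> z ws)"
      by (simp add: local_form_def fun_eq_iff)
    ultimately show ?thesis
      using True by (simp add: ext_deriv_def Let_def c_def[symmetric] local_ext_deriv_def
          right_diff_distrib sum_subtractf)
  qed (auto simp: ext_deriv_def)
qed

lemma forms_diff:
  assumes "\<omega> \<in> forms A p" "\<eta> \<in> forms A p"
  shows "(\<lambda>x vs. \<omega> x vs - \<eta> x vs) \<in> forms A p"
proof (rule formsI)
  fix x assume x: "x \<in> carrier A"
  define c where "c = chart_at A x"
  have c: "c \<in> A" "x \<in> fst c" using chart_at_props x by (auto simp: c_def)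
  let ?F = "\<lambda>\<theta>. local_form A c \<theta> (snd c x)"
  have "multilinear p (?F \<theta>)" "alternating p (?F \<theta>)" if "\<theta> \<in> forms A p" for \<theta>
    using form_on_local_form[OF that c(1)] c by (auto simp: form_on_def)
  then have "multilinear p (\<lambda>ws. ?F \<omega> ws - ?F \<eta> ws)" "alternating p (\<lambda>ws. ?F \<omega> ws - ?F \<eta> ws)"
    using assms by (auto intro: multilinear_diff alternating_diff)
  then show "\<exists>c F. c \<in> A \<and> x \<in> fst c \<and> multilinear p F \<and> alternating p F \<and>
       (\<forall>vs. length vs = p \<longrightarrow> set vs \<subseteq> tangent_space A x \<longrightarrow> \<omega> x vs - \<eta> x vs = F (map (\<lambda>v. v c) vs))"
    using c local_form_components[OF c]
    by (intro exI[of _ c] exI[of _ "\<lambda>ws. ?F \<omega> ws - ?F \<eta> ws"]) auto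
next
  fix c ws assume c: "c \<in> A"
  show "smooth_on (\<lambda>y. local_form A c (\<lambda>x vs. \<omega> x vs - \<eta> x vs) y ws) (snd c ` fst c)"
    using assms c smooth_on_diff[OF open_chart_image[OF c], of "\<lambda>y. local_form A c \<omega> y ws" "\<lambda>y. local_form A c \<eta> y ws"]
    by (simp add: forms_def local_form_def)
next
  fix x vs assume n: "\<not> (x \<in> carrier A \<and> length vs = p \<and> set vs \<subseteq> tangent_space A x)"
  show "\<omega> x vs - \<eta> x vs = 0"
    using forms_vanish[OF assms(1) n] forms_vanish[OF assms(2) n] by simp
qed

lemma zero_form_closed: "zero_form \<in> closed_forms A p"
proof -
  have "zero_form \<in> forms A p"
    by (auto simp: forms_def zero_form_def local_form_def smooth_on_const)
  moreover have "ext_deriv A zero_form = zero_form"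
    by (intro ext) (simp add: ext_deriv_def zero_form_def local_ext_deriv_def local_form_def Let_def)
  ultimately show ?thesis by (simp add: closed_forms_def)
qed

end

section \<open>The tangent bundle\<close>

text \<open>The second component \<open>D\<tau>(z) u\<close> is linear in \<open>u\<close>; expanding \<open>u\<close> in the frame makes it a sum of
products of differentiable functions. Reassembling the derivative uses that \<open>D(z \<mapsto> D\<tau>(z) u) a\<close> is
linear in \<open>u\<close>, which is clear after exchanging \<open>u\<close> and \<open>a\<close>.\<close>

lemma has_derivative_tangent_map:
  fixes \<tau> :: "'b::real_inner \<Rightarrow> 'b" and e :: "nat \<Rightarrow> 'b"
  assumes fr: "euclidean_frame e m" and S: "open S" and \<tau>: "smooth_on \<tau> S" and y: "y \<in> S"
  shows "((\<lambda>(z, u). (\<tau> z, frechet_derivative \<tau> (at z) u)) has_derivative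
    (\<lambda>(a, b). (frechet_derivative \<tau> (at y) a,
       frechet_derivative (\<lambda>z. frechet_derivative \<tau> (at z) u) (at y) a + frechet_derivative \<tau> (at y) b))) (at (y, u))"
proof -
  let ?D = "\<lambda>z. frechet_derivative \<tau> (at z)"
  let ?H = "\<lambda>u. frechet_derivative (\<lambda>z. ?D z u) (at y)"
  have op: "open (S \<times> (UNIV :: 'b set))" using S by (rule open_Times) simp
  have expand: "?D z w = (\<Sum>j<m. (w \<bullet> e j) *\<^sub>R ?D z (e j))" if "z \<in> S" for z w
    by (rule linear_frame_expansion[OF fr linear_frechet_derivative[OF smooth_on_differentiable[OF \<tau> that]]])
  have dD: "((\<lambda>z. ?D z w) has_derivative ?H w) (at y)" for w
    using smooth_on_differentiable[OF smooth_on_derivative[OF \<tau>] y] by (simp add: frechet_derivative_works)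
  have sym: "?H w a = ?H a w" for w a
    by (rule second_derivative_symmetric[OF S smooth_on_C2[OF \<tau>] y])
  have Hexp: "?H u a = (\<Sum>j<m. (u \<bullet> e j) *\<^sub>R ?H (e j) a)" for a
    using linear_frame_expansion[OF fr has_derivative_linear[OF dD[of a]], of u] by (simp add: sym[of a])
  have fst: "((\<lambda>p. g (fst p)) has_derivative (\<lambda>h. g' (fst h))) (at (y, u))"
    if "(g has_derivative g') (at y)" for g g' :: "'b \<Rightarrow> 'b"
    using diff_chain_at[of fst fst "(y, u)" g g'] that
    by (simp add: o_def bounded_linear_imp_has_derivative bounded_linear_fst)
  have "((\<lambda>p. (snd p \<bullet> e j) *\<^sub>R ?D (fst p) (e j)) has_derivative
      (\<lambda>h. (u \<bullet> e j) *\<^sub>R ?H (e j) (fst h) + (snd h \<bullet> e j) *\<^sub>R ?D y (e j))) (at (y, u))" for j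
    using has_derivative_scaleR[OF has_derivative_inner_left[OF
        bounded_linear_imp_has_derivative[OF bounded_linear_snd]] fst[OF dD[of "e j"]], of "e j"] by simp
  then have "((\<lambda>p. \<Sum>j<m. (snd p \<bullet> e j) *\<^sub>R ?D (fst p) (e j)) has_derivative
      (\<lambda>h. \<Sum>j<m. (u \<bullet> e j) *\<^sub>R ?H (e j) (fst h) + (snd h \<bullet> e j) *\<^sub>R ?D y (e j))) (at (y, u))"
    by (rule has_derivative_sum)
  moreover have "(\<Sum>j<m. (u \<bullet> e j) *\<^sub>R ?H (e j) (fst h) + (snd h \<bullet> e j) *\<^sub>R ?D y (e j))
      = ?H u (fst h) + ?D y (snd h)" for h
    by (simp add: sum.distrib Hexp[of "fst h"] expand[OF y, of "snd h"])
  ultimately have "((\<lambda>p. \<Sum>j<m. (snd p \<bullet> e j) *\<^sub>R ?D (fst p) (e j)) has_derivative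
      (\<lambda>h. ?H u (fst h) + ?D y (snd h))) (at (y, u))" by simp
  moreover have "((\<lambda>p. \<tau> (fst p)) has_derivative (\<lambda>h. ?D y (fst h))) (at (y, u))"
    using smooth_on_differentiable[OF \<tau> y] by (intro fst) (simp add: frechet_derivative_works)
  ultimately have "((\<lambda>p. (\<tau> (fst p), \<Sum>j<m. (snd p \<bullet> e j) *\<^sub>R ?D (fst p) (e j))) has_derivative
      (\<lambda>h. (?D y (fst h), ?H u (fst h) + ?D y (snd h)))) (at (y, u))"
    by (intro has_derivative_Pair)
  then have "((\<lambda>(z, u). (\<tau> z, ?D z u)) has_derivative (\<lambda>h. (?D y (fst h), ?H u (fst h) + ?D y (snd h)))) (at (y, u))"
    by (rule has_derivative_transform_within_open[OF _ op]) (use y expand in auto)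
  then show ?thesis by (simp add: case_prod_unfold)
qed

lemma length_index_list: "I \<subseteq> {..<m::nat} \<Longrightarrow> length (sorted_list_of_set I) = card I"
  using finite_subset[of I "{..<m}"] by simp

text \<open>The formula for the lift is a combination of wedge products, whatever \<open>f\<close> is.\<close>

lemma
  fixes f :: "'e::real_inner \<Rightarrow> 'e list \<Rightarrow> real"
  shows multilinear_local_complete_lift: "multilinear n (local_complete_lift e m f z)" (is ?ml)
    and alternating_local_complete_lift: "alternating n (local_complete_lift e m f z)" (is ?al)
proof -
  obtain y u where z: "z = (y, u)" by fastforce
  let ?S = "{I. I \<subseteq> {..<m} \<and> card I = n}"
  let ?l = "\<lambda>I. sorted_list_of_set I :: nat list"
  define G where "G = (\<lambda>ws. \<Sum>I\<in>?S.
     (\<Sum>j<m. (u \<bullet> e j) * frechet_derivative (\<lambda>z. f z (map e (?l I))) (at y) (e j)) * wedge (map (dx e) (?l I)) ws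
     + f y (map e (?l I)) * (\<Sum>k<length (?l I). wedge ((map (dx e) (?l I))[k := dv e (?l I ! k)]) ws))"
  have eq: "local_complete_lift e m f z ws = G ws" if "length ws = n" for ws
    by (simp add: local_complete_lift_def z G_def Let_def that)
  have lin: "linear (dx e i)" "linear (dv e i)" for i
    by (auto intro!: linearI simp: dx_def dv_def inner_add_left case_prod_unfold)
  have len: "length (map (dx e) (?l I)) = n" "length ((map (dx e) (?l I))[k := dv e (?l I ! k)]) = n"
    if "I \<in> ?S" for I k
    using that length_index_list by auto
  have lins: "linear \<theta>" if "\<theta> \<in> set ((map (dx e) (?l I))[k := dv e (?l I ! k)])" for \<theta> I k
    using that lin set_update_subset_insert[of "map (dx e) (?l I)" k "dv e (?l I ! k)"] by auto
  have w: "multilinear n (wedge (map (dx e) (?l I)))" "alternating n (wedge (map (dx e) (?l I)))"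
    "multilinear n (wedge ((map (dx e) (?l I))[k := dv e (?l I ! k)]))"
    "alternating n (wedge ((map (dx e) (?l I))[k := dv e (?l I ! k)]))"
    if "I \<in> ?S" for I k
    using multilinear_wedge[of "map (dx e) (?l I)"] alternating_wedge[of "map (dx e) (?l I)"] lin
      multilinear_wedge[of "(map (dx e) (?l I))[k := dv e (?l I ! k)]", OF lins]
      alternating_wedge[of "(map (dx e) (?l I))[k := dv e (?l I ! k)]"]
    unfolding len[OF that] by auto
  have "multilinear n G" unfolding G_def
    by (intro multilinear_sum multilinear_add multilinear_cmult w) auto
  then show ?ml unfolding multilinear_def by (simp add: eq)
  have "alternating n G" unfolding G_def
    by (intro alternating_sum alternating_add alternating_cmult w) auto
  then show ?al unfolding alternating_def by (simp add: eq)
qed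

locale smooth_atlas = differentiable_atlas A for A :: "('a, 'e::real_inner) chart set" +
  fixes e :: "nat \<Rightarrow> 'e" and m :: nat
  assumes frame: "euclidean_frame e m"
    and smooth_transition: "c \<in> A \<Longrightarrow> c' \<in> A \<Longrightarrow> smooth_on (transition c c') (snd c ` (fst c \<inter> fst c'))"

lemma smooth_manifold_smooth_atlas:
  assumes fr: "euclidean_frame e m" and M: "smooth_manifold X A"
  shows "smooth_atlas A e m"
proof -
  have chart: "openin X (fst c)" "open (snd c ` fst c)"
      "homeomorphic_map (subtopology X (fst c)) (top_of_set (snd c ` fst c)) (snd c)" if "c \<in> A" for c
    using M that unfolding smooth_manifold_def case_prod_unfold by blast+
  have sm: "smooth_on (transition c c') (snd c ` (fst c \<inter> fst c'))" if "c \<in> A" "c' \<in> A" for c c'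
    using M that unfolding smooth_manifold_def by blast
  show ?thesis
  proof
    fix c assume c: "c \<in> A"
    have "topspace (subtopology X (fst c)) = fst c"
      using openin_subset[OF chart(1)[OF c]] by (simp add: topspace_subtopology Int_absorb1)
    then show "inj_on (snd c) (fst c)"
      using homeomorphic_imp_injective_map[OF chart(3)[OF c]] by simp
  next
    fix c c' assume c: "c \<in> A" "c' \<in> A"
    have "openin (subtopology X (fst c)) (fst c \<inter> fst c')"
      using chart(1)[OF c(2)] by (metis inf_commute openin_subtopology)
    then have "openin (top_of_set (snd c ` fst c)) (snd c ` (fst c \<inter> fst c'))"
      using homeomorphic_imp_open_map[OF chart(3)[OF c(1)]] unfolding open_map_def by blast
    then show "open (snd c ` (fst c \<inter> fst c'))"
      using chart(2)[OF c(1)] by (simp add: openin_open_eq)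
  next
    fix c c' x assume c: "c \<in> A" "c' \<in> A" and x: "x \<in> fst c" "x \<in> fst c'"
    show "transition c c' differentiable at (snd c x)"
      by (rule smooth_on_differentiable[OF sm[OF c]]) (use x in auto)
  qed (use fr sm in auto)
qed

context smooth_atlas
begin

abbreviation "TA \<equiv> tangent_atlas A"
abbreviation "TC \<equiv> tangent_chart A"

abbreviation hessian where
  "hessian c c' x u \<equiv>
     frechet_derivative (\<lambda>z. frechet_derivative (transition c c') (at z) u) (at (snd c x))"

lemma in_tangent_chart: "q \<in> fst (TC c) \<longleftrightarrow> fst q \<in> fst c \<and> snd q \<in> tangent_space A (fst q)"
  by (cases q) (auto simp: tangent_chart_def)

lemma tangent_chart_coords: "snd (TC c) q = (snd c (fst q), snd q c)"
  by (simp add: tangent_chart_def case_prod_unfold)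

lemma tangent_chart_tvec_of:
  assumes "c \<in> A" "x \<in> fst c"
  shows "(x, tvec_of A c x u) \<in> fst (TC c)" "snd (TC c) (x, tvec_of A c x u) = (snd c x, u)"
  using assms by (simp_all add: in_tangent_chart tangent_chart_coords tvec_of_in_tangent_space)

lemma tangent_chart_image:
  assumes c: "c \<in> A"
  shows "snd (TC c) ` (fst (TC c) \<inter> fst (TC c')) = (snd c ` (fst c \<inter> fst c')) \<times> UNIV"
proof
  show "snd (TC c) ` (fst (TC c) \<inter> fst (TC c')) \<subseteq> (snd c ` (fst c \<inter> fst c')) \<times> UNIV"
    by (auto simp: in_tangent_chart tangent_chart_coords)
next
  show "(snd c ` (fst c \<inter> fst c')) \<times> UNIV \<subseteq> snd (TC c) ` (fst (TC c) \<inter> fst (TC c'))"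
  proof clarify
    fix x u assume x: "x \<in> fst c" "x \<in> fst c'"
    show "(snd c x, u) \<in> snd (TC c) ` (fst (TC c) \<inter> fst (TC c'))"
      by (rule image_eqI[of _ _ "(x, tvec_of A c x u)"])
         (use c x in \<open>auto simp: in_tangent_chart tangent_chart_coords tvec_of_in_tangent_space\<close>)
  qed
qed

lemma tangent_chart_full_image: "c \<in> A \<Longrightarrow> snd (TC c) ` fst (TC c) = (snd c ` fst c) \<times> UNIV"
  using tangent_chart_image[of c c] by simp

lemma tangent_chart_point:
  assumes c: "c \<in> A" and "z \<in> (snd c ` fst c) \<times> UNIV"
  obtains q where "q \<in> fst (TC c)" "z = snd (TC c) q"
proof -
  have "z \<in> snd (TC c) ` fst (TC c)" unfolding tangent_chart_full_image[OF c] by (rule assms(2))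
  then show ?thesis using that by blast
qed

lemma tangent_chart_inj:
  assumes c: "c \<in> A"
  shows "inj_on (snd (TC c)) (fst (TC c))"
proof (rule inj_onI)
  fix q q' assume q: "q \<in> fst (TC c)" "q' \<in> fst (TC c)" "snd (TC c) q = snd (TC c) q'"
  then have x: "fst q = fst q'"
    using inj_onD[OF chart_inj[OF c], of "fst q" "fst q'"] by (auto simp: in_tangent_chart tangent_chart_coords)
  have "snd q = tvec_of A c (fst q) (snd q c)" "snd q' = tvec_of A c (fst q') (snd q' c)"
    using q c by (auto simp: in_tangent_chart tvec_of_components)
  then show "q = q'" using q(3) x by (simp add: tangent_chart_coords prod_eq_iff)
qed

lemma tangent_chart_inv: "c \<in> A \<Longrightarrow> q \<in> fst (TC c) \<Longrightarrow> chart_inv (TC c) (snd (TC c) q) = q"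
  unfolding chart_inv_def by (rule inv_into_f_f[OF tangent_chart_inj])

text \<open>By the transformation rule of tangent vectors, the transition maps of the induced charts are the
tangent maps of the transition maps of \<open>A\<close>.\<close>

lemma tangent_transition_has_derivative:
  assumes c: "c \<in> A" "c' \<in> A" and q: "q \<in> fst (TC c)" "q \<in> fst (TC c')"
  shows "(transition (TC c) (TC c') has_derivative
     (\<lambda>(a, b). (jacobian c c' (fst q) a, hessian c c' (fst q) (snd q c) a + jacobian c c' (fst q) b)))
     (at (snd (TC c) q))"
proof -
  let ?\<tau> = "transition c c'"
  let ?S = "snd c ` (fst c \<inter> fst c')"
  have S: "open ?S" by (rule open_overlap[OF c])
  have y: "snd c (fst q) \<in> ?S" using q by (auto simp: in_tangent_chart)
  have eq: "(?\<tau> z, frechet_derivative ?\<tau> (at z) u) = transition (TC c) (TC c') (z, u)" if "z \<in> ?S" for z u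
  proof -
    obtain x where x: "x \<in> fst c" "x \<in> fst c'" "z = snd c x" using \<open>z \<in> ?S\<close> by blast
    let ?q = "(x, tvec_of A c x u)"
    have "transition (TC c) (TC c') (z, u) = snd (TC c') (chart_inv (TC c) (snd (TC c) ?q))"
      using tangent_chart_tvec_of[OF c(1) x(1)] x(3) by (simp add: transition_def)
    also have "\<dots> = snd (TC c') ?q" by (simp only: tangent_chart_inv[OF c(1) tangent_chart_tvec_of(1)[OF c(1) x(1)]])
    also have "\<dots> = (?\<tau> z, frechet_derivative ?\<tau> (at z) u)"
      using tangent_vector_component[OF tvec_of_in_tangent_space[OF c(1) x(1)] c x(1,2), of u] c x
      by (simp add: tangent_chart_coords transition_chart)
    finally show ?thesis ..
  qed
  show ?thesis
    unfolding tangent_chart_coords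
    by (rule has_derivative_transform_within_open[OF
          has_derivative_tangent_map[OF frame S smooth_transition[OF c] y] open_Times[OF S open_UNIV]])
       (use y eq in auto)
qed

end

sublocale smooth_atlas \<subseteq> TM: differentiable_atlas "tangent_atlas A"
proof
  fix C assume "C \<in> TA"
  then show "inj_on (snd C) (fst C)" using tangent_chart_inj by (auto simp: tangent_atlas_def)
next
  fix C C' assume "C \<in> TA" "C' \<in> TA"
  then obtain c c' where c: "c \<in> A" "c' \<in> A" "C = TC c" "C' = TC c'" by (auto simp: tangent_atlas_def)
  show "open (snd C ` (fst C \<inter> fst C'))"
    using tangent_chart_image[of c c'] open_overlap[of c c'] c by (simp add: open_Times)
  show "transition C C' differentiable at (snd C q)" if "q \<in> fst C" "q \<in> fst C'" for q
    using tangent_transition_has_derivative[of c c' q] that c unfolding differentiable_def by blast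
qed

context smooth_atlas
begin

lemma tangent_chart_in_atlas: "c \<in> A \<Longrightarrow> TC c \<in> TA"
  by (simp add: tangent_atlas_def)

lemma tangent_chart_cases:
  assumes "q \<in> carrier TA"
  obtains c where "c \<in> A" "q \<in> fst (TC c)"
  using assms by (auto simp: carrier_def tangent_atlas_def)

lemma base_chart:
  assumes "q \<in> carrier TA"
  shows "chart_at A (fst q) \<in> A" "q \<in> fst (TC (chart_at A (fst q)))"
proof -
  obtain c where c: "c \<in> A" "q \<in> fst (TC c)" by (rule tangent_chart_cases[OF assms])
  then have "fst q \<in> carrier A" by (auto simp: in_tangent_chart carrier_def)
  then show "chart_at A (fst q) \<in> A" "q \<in> fst (TC (chart_at A (fst q)))"
    using chart_at_props c by (auto simp: in_tangent_chart)
qed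

lemma tangent_jacobian:
  "c \<in> A \<Longrightarrow> c' \<in> A \<Longrightarrow> q \<in> fst (TC c) \<Longrightarrow> q \<in> fst (TC c') \<Longrightarrow>
    TM.jacobian (TC c) (TC c') q
      = (\<lambda>(a, b). (jacobian c c' (fst q) a, hessian c c' (fst q) (snd q c) a + jacobian c c' (fst q) b))"
  by (rule frechet_derivative_at[OF tangent_transition_has_derivative, symmetric])

text \<open>The field is defined through one chosen chart; the formula holds in all charts since the vertical vector
\<open>(0, u)\<close> is transformed into \<open>(0, D\<tau>(y) u)\<close>.\<close>

lemma tautological_field_in_chart:
  assumes c: "c \<in> A" and q: "q \<in> fst (TC c)"
  shows "tautological_field A q = tvec_of TA (TC c) q (0, snd q c)"
proof -
  define c0 where "c0 = chart_at A (fst q)"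
  have "q \<in> carrier TA" using TM.in_carrier tangent_chart_in_atlas c q by blast
  then have c0: "c0 \<in> A" "q \<in> fst (TC c0)" using base_chart by (auto simp: c0_def)
  have x: "fst q \<in> fst c0" "fst q \<in> fst c" and v: "snd q \<in> tangent_space A (fst q)"
    using q c0 by (auto simp: in_tangent_chart)
  have "smooth_on (\<lambda>z. frechet_derivative (transition c0 c) (at z) (snd q c0)) (snd c0 ` (fst c0 \<inter> fst c))"
    by (rule smooth_on_derivative[OF smooth_transition[OF c0(1) c]])
  then have "linear (hessian c0 c (fst q) (snd q c0))"
    using x by (intro linear_frechet_derivative smooth_on_differentiable) auto
  then have "TM.jacobian (TC c0) (TC c) q (0, snd q c0) = (0, snd q c)"
    using linear_jacobian[OF c0(1) c x] tangent_vector_component[OF v c0(1) c x]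
    by (simp add: tangent_jacobian c0 c q linear_0)
  moreover have "tautological_field A q = tvec_of TA (TC c0) q (0, snd q c0)"
    by (simp add: tautological_field_def Let_def c0_def)
  ultimately show ?thesis
    using TM.tvec_of_change_chart[of "TC c0" "TC c" q "(0, snd q c0)"] c c0 q tangent_chart_in_atlas by simp
qed

lemma tautological_field_tangent:
  assumes "q \<in> carrier TA"
  shows "tautological_field A q \<in> tangent_space TA q"
proof -
  obtain c where c: "c \<in> A" "q \<in> fst (TC c)" by (rule tangent_chart_cases[OF assms])
  then show ?thesis
    using TM.tvec_of_in_tangent_space[OF tangent_chart_in_atlas[OF c(1)] c(2)] by (simp add: tautological_field_in_chart)
qed

section \<open>The complete lift\<close>

text \<open>The definition evaluates the lift in one chosen chart. The arguments, being tangent vectors to \<open>TM\<close>,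
pass to any other induced chart by the derivative of the tangent map, so naturality applies.\<close>

lemma complete_lift_in_chart:
  assumes \<alpha>: "\<alpha> \<in> forms A p" and c: "c \<in> A" and q: "q \<in> fst (TC c)"
    and vs: "set vs \<subseteq> tangent_space TA q" and len: "length vs = p"
  shows "complete_lift e m A \<alpha> q vs
    = intrinsic_lift (local_form A c \<alpha>) (snd (TC c) q) (map (\<lambda>v. v (TC c)) vs)"
proof -
  define c0 where "c0 = chart_at A (fst q)"
  have qT: "q \<in> carrier TA" using TM.in_carrier tangent_chart_in_atlas c q by blast
  then have c0: "c0 \<in> A" "q \<in> fst (TC c0)" using base_chart by (auto simp: c0_def)
  let ?x = "fst q"
  have x: "?x \<in> fst c" "?x \<in> fst c0" and v: "snd q \<in> tangent_space A ?x"
    using q c0 by (auto simp: in_tangent_chart)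
  have f0: "form_on (snd c0 ` fst c0) p (local_form A c0 \<alpha>)" by (rule form_on_local_form[OF \<alpha> c0(1)])
  have "complete_lift e m A \<alpha> q vs
      = local_complete_lift e m (local_form A c0 \<alpha>) (snd c0 ?x, snd q c0) (map (\<lambda>v. v (TC c0)) vs)"
    using qT vs by (simp add: complete_lift_def Let_def c0_def[symmetric] tangent_chart_coords)
  also have "\<dots> = intrinsic_lift (local_form A c0 \<alpha>) (snd c0 ?x, snd q c0) (map (\<lambda>v. v (TC c0)) vs)"
    by (rule local_complete_lift_eq_intrinsic_lift[OF frame open_chart_image[OF c0(1)] f0]) (use x len in auto)
  also have "\<dots> = intrinsic_lift (local_form A c \<alpha>) (snd c ?x, snd q c) (map (\<lambda>v. v (TC c)) vs)"
  proof -
    let ?J = "jacobian c c0 ?x"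
    let ?DT = "\<lambda>(a, b). (?J a, hessian c c0 ?x (snd q c) a + ?J b)"
    have "intrinsic_lift (local_form A c \<alpha>) (snd c ?x, snd q c) (map (\<lambda>v. v (TC c)) vs)
      = intrinsic_lift (local_form A c0 \<alpha>) (transition c c0 (snd c ?x), ?J (snd q c)) (map ?DT (map (\<lambda>v. v (TC c)) vs))"
    proof (rule intrinsic_lift_natural[OF frame open_overlap[OF c c0(1)] open_chart_image[OF c0(1)]
          smooth_transition[OF c c0(1)] _ f0 local_form_change_chart[OF c c0(1)]])
      show "transition c c0 ` snd c ` (fst c \<inter> fst c0) \<subseteq> snd c0 ` fst c0"
        using c by (auto simp: transition_chart)
    qed (use x len in auto)
    moreover have "transition c c0 (snd c ?x) = snd c0 ?x" using c x by (simp add: transition_chart)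
    moreover have "?J (snd q c) = snd q c0" using tangent_vector_component[OF v c c0(1) x] ..
    moreover have "?DT (v (TC c)) = v (TC c0)" if "v \<in> set vs" for v
    proof -
      have "v (TC c0) = TM.jacobian (TC c) (TC c0) q (v (TC c))"
        using that vs q c0 c tangent_chart_in_atlas by (intro TM.tangent_vector_component) auto
      then show ?thesis by (simp add: tangent_jacobian c c0 q)
    qed
    then have "map ?DT (map (\<lambda>v. v (TC c)) vs) = map (\<lambda>v. v (TC c0)) vs" by simp
    ultimately show ?thesis by (simp only:)
  qed
  finally show ?thesis by (simp add: tangent_chart_coords)
qed

text \<open>If the number of arguments is not the degree of \<open>\<alpha>\<close>, then already the coefficients of \<open>\<alpha>\<close> in the
defining formula are values on lists of the wrong length.\<close>

lemma complete_lift_vanish: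
  assumes \<alpha>: "\<alpha> \<in> forms A p" and "\<not> (q \<in> carrier TA \<and> length vs = p \<and> set vs \<subseteq> tangent_space TA q)"
  shows "complete_lift e m A \<alpha> q vs = 0"
proof (cases "q \<in> carrier TA \<and> set vs \<subseteq> tangent_space TA q")
  case True
  then have len: "length vs \<noteq> p" using assms(2) by blast
  have "local_form A c \<alpha> z (map e (sorted_list_of_set I)) = 0"
    if "I \<subseteq> {..<m}" "card I = length vs" for c z I
    unfolding local_form_def by (rule forms_vanish[OF \<alpha>]) (use len that length_index_list in auto)
  then show ?thesis
    by (auto simp: complete_lift_def local_complete_lift_def Let_def case_prod_unfold intro!: sum.neutral)
next
  case False
  then show ?thesis unfolding complete_lift_def by (rule if_not_P)
qed

lemma local_form_complete_lift:
  assumes \<alpha>: "\<alpha> \<in> forms A p" and c: "c \<in> A" and z: "z \<in> (snd c ` fst c) \<times> UNIV" and len: "length ws = p"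
  shows "local_form TA (TC c) (complete_lift e m A \<alpha>) z ws = intrinsic_lift (local_form A c \<alpha>) z ws"
proof -
  have C: "TC c \<in> TA" using tangent_chart_in_atlas c .
  obtain q where q: "q \<in> fst (TC c)" "z = snd (TC c) q" by (rule tangent_chart_point[OF c z])
  have "set (map (tvec_of TA (TC c) q) ws) \<subseteq> tangent_space TA q"
    using TM.tvec_of_in_tangent_space[OF C q(1)] by auto
  then show ?thesis
    unfolding q(2) TM.local_form_chart[OF C q(1)]
    by (subst complete_lift_in_chart[OF \<alpha> c q(1)]) (use len C q in \<open>auto simp: o_def\<close>)
qed

lemma complete_lift_form:
  assumes \<alpha>: "\<alpha> \<in> forms A p"
  shows "complete_lift e m A \<alpha> \<in> forms TA p"
proof (rule TM.formsI)
  fix q assume q: "q \<in> carrier TA"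
  define c0 where "c0 = chart_at A (fst q)"
  have c0: "c0 \<in> A" "q \<in> fst (TC c0)" using base_chart[OF q] by (auto simp: c0_def)
  show "\<exists>C F. C \<in> TA \<and> q \<in> fst C \<and> multilinear p F \<and> alternating p F \<and>
       (\<forall>vs. length vs = p \<longrightarrow> set vs \<subseteq> tangent_space TA q \<longrightarrow> complete_lift e m A \<alpha> q vs = F (map (\<lambda>v. v C) vs))"
    by (rule exI[of _ "TC c0"], rule exI[of _ "local_complete_lift e m (local_form A c0 \<alpha>) (snd (TC c0) q)"])
       (use c0 q tangent_chart_in_atlas in \<open>auto simp: multilinear_local_complete_lift
          alternating_local_complete_lift complete_lift_def Let_def c0_def[symmetric]\<close>)
next
  fix C ws assume "C \<in> TA"
  then obtain c where c: "c \<in> A" "C = TC c" by (auto simp: tangent_atlas_def)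
  let ?S = "(snd c ` fst c) \<times> (UNIV :: 'e set)"
  have op: "open ?S" by (intro open_Times open_chart_image c open_UNIV)
  have "smooth_on (\<lambda>z. local_form TA C (complete_lift e m A \<alpha>) z ws) ?S"
  proof (cases "length ws = p")
    case True
    show ?thesis
      by (rule smooth_on_cong[OF op smooth_on_intrinsic_lift[OF frame open_chart_image[OF c(1)]
            form_on_local_form[OF \<alpha> c(1)]]])
         (use True local_form_complete_lift[OF \<alpha> c(1)] c(2) in auto)
  next
    case False
    then have "local_form TA C (complete_lift e m A \<alpha>) z ws = 0" for z
      unfolding local_form_def by (intro complete_lift_vanish[OF \<alpha>]) simp
    then show ?thesis by (simp add: smooth_on_const)
  qed
  then show "smooth_on (\<lambda>z. local_form TA C (complete_lift e m A \<alpha>) z ws) (snd C ` fst C)"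
    using tangent_chart_full_image[OF c(1)] c(2) by simp
qed (rule complete_lift_vanish[OF \<alpha>])

lemma lie_deriv_complete_lift:
  assumes \<alpha>: "\<alpha> \<in> forms A p"
  shows "lie_deriv TA (tautological_field A) (complete_lift e m A \<alpha>) = complete_lift e m A \<alpha>"
proof (intro ext)
  fix q vs
  let ?L = "complete_lift e m A \<alpha>"
  show "lie_deriv TA (tautological_field A) ?L q vs = ?L q vs"
  proof (cases "q \<in> carrier TA \<and> set vs \<subseteq> tangent_space TA q")
    case True
    then have "chart_at TA q \<in> TA" "q \<in> fst (chart_at TA q)" using TM.chart_at_props by auto
    then obtain c where c: "c \<in> A" "chart_at TA q = TC c" and q: "q \<in> fst (TC c)"
      by (auto simp: tangent_atlas_def)
    have C: "TC c \<in> TA" using tangent_chart_in_atlas c(1) .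
    let ?W = "snd c ` fst c" and ?f = "local_form TA (TC c) ?L" and ?ws = "map (\<lambda>v. v (TC c)) vs"
    have z: "snd (TC c) q \<in> ?W \<times> UNIV" using q tangent_chart_full_image[OF c(1)] by blast
    have F: "tautological_field A (chart_inv (TC c) z) (TC c) = (0, snd z)" if zW: "z \<in> ?W \<times> UNIV" for z
    proof -
      obtain q' where q': "q' \<in> fst (TC c)" "z = snd (TC c) q'" by (rule tangent_chart_point[OF c(1) zW])
      show ?thesis
        unfolding q'(2) tangent_chart_inv[OF c(1) q'(1)] using C c(1) q'(1)
        by (simp add: tautological_field_in_chart tangent_chart_coords)
    qed
    have hom: "?f (fst z, k *\<^sub>R snd z) (map (\<lambda>(a, b). (a, k *\<^sub>R b)) ws) = k * ?f z ws"
      if z: "z \<in> ?W \<times> UNIV" for z k ws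
    proof (cases "length ws = p")
      case True
      have "intrinsic_lift (local_form A c \<alpha>) (fst z, k *\<^sub>R snd z) (map (\<lambda>(a, b). (a, k *\<^sub>R b)) ws)
          = k * intrinsic_lift (local_form A c \<alpha>) (fst z, snd z) ws"
        by (rule intrinsic_lift_homogeneous[OF form_on_local_form[OF \<alpha> c(1)] _ True]) (use z in auto)
      moreover have "(fst z, k *\<^sub>R snd z) \<in> ?W \<times> UNIV" using z by auto
      ultimately show ?thesis
        using z True by (simp add: local_form_complete_lift[OF \<alpha> c(1)])
    next
      case False
      then show ?thesis by (simp add: local_form_def complete_lift_vanish[OF \<alpha>])
    qed
    have "local_lie_deriv (\<lambda>z. tautological_field A (chart_inv (TC c) z) (TC c)) (?W \<times> UNIV) ?f (snd (TC c) q) ?ws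
        = ?f (snd (TC c) q) ?ws"
      by (rule local_lie_deriv_of_homogeneous[OF open_chart_image[OF c(1)] F z hom[OF z]])
    moreover have "?f (snd (TC c) q) ?ws = ?L q vs"
      using True by (intro TM.local_form_components C q) auto
    ultimately show ?thesis
      using True tangent_chart_full_image[OF c(1)] by (simp add: lie_deriv_def Let_def c(2))
  next
    case False
    then show ?thesis using complete_lift_vanish[OF \<alpha>, of q vs] by (auto simp: lie_deriv_def)
  qed
qed

section \<open>Closed forms and cohomology\<close>

text \<open>The chart chosen at a point of \<open>TM\<close> may come from a chart of \<open>M\<close> other than the one chosen at its base
point, so closedness of \<open>\<alpha>\<close> is needed in the coordinates of every chart.\<close>

lemma ext_deriv_in_chart:
  assumes \<alpha>: "\<alpha> \<in> forms A p" and c: "c \<in> A" and x: "x \<in> fst c"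
    and vs: "set vs \<subseteq> tangent_space A x" and len: "length vs = Suc p"
  shows "ext_deriv A \<alpha> x vs = local_ext_deriv (local_form A c \<alpha>) (snd c x) (map (\<lambda>v. v c) vs)"
proof -
  define c0 where "c0 = chart_at A x"
  have xA: "x \<in> carrier A" using c x by (rule in_carrier)
  then have c0: "c0 \<in> A" "x \<in> fst c0" using chart_at_props by (auto simp: c0_def)
  have "local_ext_deriv (local_form A c \<alpha>) (snd c x) (map (\<lambda>v. v c) vs)
      = local_ext_deriv (local_form A c0 \<alpha>) (transition c c0 (snd c x)) (map (jacobian c c0 x) (map (\<lambda>v. v c) vs))"
  proof (rule local_ext_deriv_natural[OF frame open_overlap[OF c c0(1)] open_chart_image[OF c0(1)]
        smooth_transition[OF c c0(1)] _ form_on_local_form[OF \<alpha> c0(1)] local_form_change_chart[OF c c0(1)]])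
    show "transition c c0 ` snd c ` (fst c \<inter> fst c0) \<subseteq> snd c0 ` fst c0"
      using c by (auto simp: transition_chart)
  qed (use x c0 len in auto)
  moreover have "map (jacobian c c0 x) (map (\<lambda>v. v c) vs) = map (\<lambda>v. v c0) vs"
    using vs tangent_vector_component[OF _ c c0(1) x c0(2)] by auto
  moreover have "transition c c0 (snd c x) = snd c0 x" using c x by (rule transition_chart)
  moreover have "ext_deriv A \<alpha> x vs = local_ext_deriv (local_form A c0 \<alpha>) (snd c0 x) (map (\<lambda>v. v c0) vs)"
    using xA vs by (simp add: ext_deriv_def Let_def c0_def[symmetric])
  ultimately show ?thesis by (simp only:)
qed

lemma closed_form_in_chart:
  assumes \<alpha>: "\<alpha> \<in> closed_forms A p" and c: "c \<in> A" and y: "y \<in> snd c ` fst c" and len: "length ws = Suc p"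
  shows "local_ext_deriv (local_form A c \<alpha>) y ws = 0"
proof -
  obtain x where x: "x \<in> fst c" "y = snd c x" using y by blast
  have sub: "set (map (tvec_of A c x) ws) \<subseteq> tangent_space A x"
    using tvec_of_in_tangent_space[OF c x(1)] by auto
  have "local_ext_deriv (local_form A c \<alpha>) y ws = ext_deriv A \<alpha> x (map (tvec_of A c x) ws)"
    using \<alpha> c x len by (subst ext_deriv_in_chart[OF _ c x(1) sub]) (auto simp: closed_forms_def o_def)
  then show ?thesis using \<alpha> by (simp add: closed_forms_def zero_form_def)
qed

lemma local_form_contraction:
  assumes c: "c \<in> A" and z: "z \<in> (snd c ` fst c) \<times> UNIV"
  shows "local_form TA (TC c) (interior_product (tautological_field A) \<omega>) z ws
    = local_form TA (TC c) \<omega> z ((0, snd z) # ws)"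
proof -
  obtain q where q: "q \<in> fst (TC c)" "z = snd (TC c) q" by (rule tangent_chart_point[OF c z])
  then show ?thesis
    using tangent_chart_in_atlas[OF c] c
    by (simp add: TM.local_form_chart interior_product_def tautological_field_in_chart)
       (simp add: tangent_chart_coords)
qed

lemma local_form_contraction_complete_lift:
  assumes \<alpha>: "\<alpha> \<in> forms A (Suc n)" and c: "c \<in> A" and z: "z \<in> (snd c ` fst c) \<times> UNIV" and len: "length ws = n"
  shows "local_form TA (TC c) (interior_product (tautological_field A) (complete_lift e m A \<alpha>)) z ws
    = local_form A c \<alpha> (fst z) (snd z # map fst ws)"
proof -
  have "intrinsic_lift (local_form A c \<alpha>) (fst z, snd z) ((0, snd z) # ws)
      = local_form A c \<alpha> (fst z) (snd z # map fst ws)"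
    using z len by (intro intrinsic_lift_contraction[OF open_chart_image[OF c] form_on_local_form[OF \<alpha> c]]) auto
  then show ?thesis
    using len by (simp add: local_form_contraction[OF c z] local_form_complete_lift[OF \<alpha> c z])
qed

lemma contraction_complete_lift_vanish:
  assumes \<alpha>: "\<alpha> \<in> forms A p"
    and "\<not> (q \<in> carrier TA \<and> Suc (length vs) = p \<and> set vs \<subseteq> tangent_space TA q)"
  shows "interior_product (tautological_field A) (complete_lift e m A \<alpha>) q vs = 0"
  unfolding interior_product_def by (rule complete_lift_vanish[OF \<alpha>]) (use assms(2) in auto)

text \<open>In coordinates the contraction is \<open>f (y; u, a\<^sub>2, \<dots>, a\<^sub>p)\<close>, which is smooth in \<open>(y, u)\<close> as it is
smooth in \<open>y\<close> and linear in \<open>u\<close>.\<close>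

lemma contraction_complete_lift_form:
  assumes \<alpha>: "\<alpha> \<in> forms A (Suc n)"
  shows "interior_product (tautological_field A) (complete_lift e m A \<alpha>) \<in> forms TA n"
proof (rule TM.formsI)
  fix q vs assume "\<not> (q \<in> carrier TA \<and> length vs = n \<and> set vs \<subseteq> tangent_space TA q)"
  then show "interior_product (tautological_field A) (complete_lift e m A \<alpha>) q vs = 0"
    by (intro contraction_complete_lift_vanish[OF \<alpha>]) auto
next
  fix q assume qT: "q \<in> carrier TA"
  obtain c where c: "c \<in> A" and q: "q \<in> fst (TC c)" by (rule tangent_chart_cases[OF qT])
  have C: "TC c \<in> TA" using tangent_chart_in_atlas c .
  let ?G = "local_form TA (TC c) (complete_lift e m A \<alpha>) (snd (TC c) q)"
  let ?F = "\<lambda>ws. ?G (tautological_field A q (TC c) # ws)"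
  have "form_on (snd (TC c) ` fst (TC c)) (Suc n) (local_form TA (TC c) (complete_lift e m A \<alpha>))"
    by (rule TM.form_on_local_form[OF complete_lift_form[OF \<alpha>] C])
  then have "multilinear n ?F" "alternating n ?F"
    using q by (auto simp: form_on_def intro!: multilinear_Cons alternating_Cons)
  moreover have "interior_product (tautological_field A) (complete_lift e m A \<alpha>) q vs = ?F (map (\<lambda>v. v (TC c)) vs)"
    if "set vs \<subseteq> tangent_space TA q" for vs
    using TM.local_form_components[OF C q, of "tautological_field A q # vs" "complete_lift e m A \<alpha>"]
      that tautological_field_tangent[OF qT] by (simp add: interior_product_def)
  ultimately show "\<exists>C F. C \<in> TA \<and> q \<in> fst C \<and> multilinear n F \<and> alternating n F \<and>
       (\<forall>vs. length vs = n \<longrightarrow> set vs \<subseteq> tangent_space TA q \<longrightarrow>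
          interior_product (tautological_field A) (complete_lift e m A \<alpha>) q vs = F (map (\<lambda>v. v C) vs))"
    using C q by (intro exI[of _ "TC c"] exI[of _ ?F]) auto
next
  fix C ws assume "C \<in> TA"
  then obtain c where c: "c \<in> A" "C = TC c" by (auto simp: tangent_atlas_def)
  let ?S = "(snd c ` fst c) \<times> (UNIV :: 'e set)"
  let ?i = "interior_product (tautological_field A) (complete_lift e m A \<alpha>)"
  have op: "open ?S" by (intro open_Times open_chart_image c open_UNIV)
  have f: "form_on (snd c ` fst c) (Suc n) (local_form A c \<alpha>)" by (rule form_on_local_form[OF \<alpha> c(1)])
  have "smooth_on (\<lambda>z. local_form TA C ?i z ws) ?S"
  proof (cases "length ws = n")
    case True
    have "smooth_on (\<lambda>z. \<Sum>j<m. (snd z \<bullet> e j) * local_form A c \<alpha> (fst z) (e j # map fst ws)) ?S"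
      using f
      by (intro smooth_on_sum smooth_on_mult op smooth_on_bounded_linear[OF op] bounded_linear_inner_left_comp
          bounded_linear_snd smooth_on_compose_fst[of _ "\<lambda>y. local_form A c \<alpha> y (e _ # map fst ws)"]
          open_chart_image c) (auto simp: form_on_def)
    then show ?thesis
    proof (rule smooth_on_cong[OF op])
      fix z assume z: "z \<in> ?S"
      have "multilinear (Suc n) (local_form A c \<alpha> (fst z))" using f z by (auto simp: form_on_def)
      then show "(\<Sum>j<m. (snd z \<bullet> e j) * local_form A c \<alpha> (fst z) (e j # map fst ws)) = local_form TA C ?i z ws"
        using True z c(2) multilinear_expand_first[OF frame, of n "local_form A c \<alpha> (fst z)" "map fst ws" "snd z"]
        by (simp add: local_form_contraction_complete_lift[OF \<alpha> c(1)])
    qed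
  next
    case False
    then have "local_form TA C ?i z ws = 0" for z
      unfolding local_form_def by (intro contraction_complete_lift_vanish[OF \<alpha>]) simp
    then show ?thesis by (simp add: smooth_on_const)
  qed
  then show "smooth_on (\<lambda>z. local_form TA C ?i z ws) (snd C ` fst C)"
    using tangent_chart_full_image[OF c(1)] c(2) by simp
qed

lemma closed_lift_eq_ext_deriv:
  assumes \<alpha>: "\<alpha> \<in> closed_forms A p"
  shows "complete_lift e m A \<alpha>
    = ext_deriv TA (interior_product (tautological_field A) (complete_lift e m A \<alpha>))"
proof (intro ext)
  fix q vs
  let ?L = "complete_lift e m A \<alpha>"
  let ?i = "interior_product (tautological_field A) ?L"
  have f: "\<alpha> \<in> forms A p" using \<alpha> by (simp add: closed_forms_def)
  show "?L q vs = ext_deriv TA ?i q vs"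
  proof (cases "q \<in> carrier TA \<and> set vs \<subseteq> tangent_space TA q")
    case True
    then have "chart_at TA q \<in> TA" "q \<in> fst (chart_at TA q)" using TM.chart_at_props by auto
    then obtain c where c: "c \<in> A" "chart_at TA q = TC c" and q: "q \<in> fst (TC c)"
      by (auto simp: tangent_atlas_def)
    let ?ws = "map (\<lambda>v. v (TC c)) vs" and ?y = "snd c (fst q)" and ?u = "snd q c"
    let ?g = "local_form TA (TC c) ?i" and ?f = "local_form A c \<alpha>"
    have y: "?y \<in> snd c ` fst c" using q by (auto simp: in_tangent_chart)
    have ed: "ext_deriv TA ?i q vs = local_ext_deriv ?g (?y, ?u) ?ws"
      using True by (simp add: ext_deriv_def Let_def c(2) tangent_chart_coords)
    show ?thesis
    proof (cases "length vs = p")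
      case len: True
      have L: "?L q vs = intrinsic_lift ?f (?y, ?u) ?ws"
        using complete_lift_in_chart[OF f c(1) q] True len by (simp add: tangent_chart_coords)
      have closed: "local_ext_deriv ?f ?y (?u # map fst ?ws) = 0"
        using len by (intro closed_form_in_chart[OF \<alpha> c(1) y]) simp
      show ?thesis
      proof (cases p)
        case 0
        then show ?thesis using closed L ed len by (simp add: local_ext_deriv_def intrinsic_lift_def)
      next
        case (Suc n)
        have "local_ext_deriv ?g (?y, ?u) ?ws = intrinsic_lift ?f (?y, ?u) ?ws"
          by (rule lift_eq_ext_deriv_of_contraction[OF frame open_chart_image[OF c(1)]
                form_on_local_form[OF f[unfolded Suc] c(1)] y _ closed])
             (use len Suc local_form_contraction_complete_lift[OF f[unfolded Suc] c(1)] in auto)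
        then show ?thesis using L ed by simp
      qed
    next
      case len: False
      have "?g z (take i ?ws @ drop (Suc i) ?ws) = 0" if "i < length vs" for z i
        unfolding local_form_def by (rule contraction_complete_lift_vanish[OF f]) (use len that in auto)
      then have "local_ext_deriv ?g (?y, ?u) ?ws = 0" by (simp add: local_ext_deriv_def)
      then show ?thesis using ed complete_lift_vanish[OF f, of q vs] len by simp
    qed
  next
    case False
    then show ?thesis using complete_lift_vanish[OF f, of q vs] by (auto simp: ext_deriv_def)
  qed
qed

text \<open>In degree \<open>0\<close> the contraction is the zero form, so the lift itself vanishes.\<close>

lemma complete_lift_exact:
  assumes \<alpha>: "\<alpha> \<in> closed_forms A p"
  shows "complete_lift e m A \<alpha> \<in> exact_forms TA p"
proof (cases p)
  case 0
  have f: "\<alpha> \<in> forms A 0" using \<alpha> 0 by (simp add: closed_forms_def)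
  have "interior_product (tautological_field A) (complete_lift e m A \<alpha>) = zero_form"
    by (intro ext) (simp add: zero_form_def contraction_complete_lift_vanish[OF f])
  then have "complete_lift e m A \<alpha> = zero_form"
    using closed_lift_eq_ext_deriv[OF \<alpha>] TM.zero_form_closed[of 0] by (simp add: closed_forms_def)
  then show ?thesis using 0 by (simp add: exact_forms_def)
next
  case (Suc n)
  have "\<alpha> \<in> forms A (Suc n)" using \<alpha> Suc by (simp add: closed_forms_def)
  from contraction_complete_lift_form[OF this] show ?thesis
    using closed_lift_eq_ext_deriv[OF \<alpha>] Suc by (auto simp: exact_forms_def)
qed

text \<open>Exact forms are closed under differences, so the relation identifies all lifts of closed forms.\<close>

lemma lift_cohomology_trivial:
  "lift_cohomology e m A p = {cohomologous_lifts e m A p `` {zero_form}}"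
proof -
  let ?Z = "closed_lifts e m A p"
  have diff: "(\<lambda>q vs. \<eta> q vs - \<theta> q vs) \<in> exact_forms TA p"
    if exact: "\<eta> \<in> exact_forms TA p" "\<theta> \<in> exact_forms TA p" for \<eta> \<theta>
  proof (cases p)
    case 0
    then show ?thesis using exact by (simp add: exact_forms_def zero_form_def)
  next
    case (Suc n)
    then obtain \<beta> \<gamma> where "\<beta> \<in> forms TA n" "\<gamma> \<in> forms TA n" "\<eta> = ext_deriv TA \<beta>" "\<theta> = ext_deriv TA \<gamma>"
      using exact by (auto simp: exact_forms_def)
    then show ?thesis
      using TM.ext_deriv_diff[of \<beta> n \<gamma>] TM.forms_diff[of \<beta> n \<gamma>] Suc
      by (auto simp: exact_forms_def intro!: image_eqI[of _ _ "\<lambda>q vs. \<beta> q vs - \<gamma> q vs"])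
  qed
  have "?Z \<subseteq> exact_forms TA p" using complete_lift_exact by (auto simp: closed_lifts_def)
  then have R: "cohomologous_lifts e m A p = ?Z \<times> ?Z"
    using diff by (auto simp: cohomologous_lifts_def)
  have "complete_lift e m A zero_form = zero_form"
    by (intro ext) (simp add: complete_lift_def local_complete_lift_def local_form_def zero_form_def Let_def case_prod_unfold)
  then have "zero_form \<in> ?Z" using zero_form_closed[of p] unfolding closed_lifts_def by (metis image_eqI)
  then show ?thesis unfolding lift_cohomology_def R quotient_def by auto
qed

end

theorem theorem1:
  fixes X :: "'a topology"
    and A :: "('a, 'e::real_inner) chart set"
    and e :: "nat \<Rightarrow> 'e"
    and m :: nat
  assumes "euclidean_frame e m"
    and "smooth_manifold X A"
  shows "(\<forall>p. \<forall>\<alpha>\<in>forms A p.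
            complete_lift e m A \<alpha> \<in> forms (tangent_atlas A) p \<and>
            lie_deriv (tangent_atlas A) (tautological_field A) (complete_lift e m A \<alpha>)
              = complete_lift e m A \<alpha>) \<and>
         (\<forall>p. \<forall>\<alpha>\<in>closed_forms A p.
            complete_lift e m A \<alpha> \<in> exact_forms (tangent_atlas A) p \<and>
            complete_lift e m A \<alpha>
              = ext_deriv (tangent_atlas A) (interior_product (tautological_field A) (complete_lift e m A \<alpha>))) \<and>
         (\<forall>p\<le>m. lift_cohomology e m A p = {cohomologous_lifts e m A p `` {zero_form}})"
proof -
  interpret smooth_atlas A e m by (rule smooth_manifold_smooth_atlas[OF assms])
  show ?thesis
    by (intro conjI allI impI ballI complete_lift_form lie_deriv_complete_lift complete_lift_exact
        closed_lift_eq_ext_deriv lift_cohomology_trivial)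
qed

end
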